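(* Let $p=p(n)\in(0,1)$. For any given integer $k\ge 1$, let $Z^{(k)}_n$ be the $k$-th order generalized Zagreb index of the random graph $G(n,p)$. If $n^2p(1-p)\to\infty$ as $n\to\infty$, then $$\frac{Z^{(k)}_{n}-\sum_{m=1}^k\genfrac\{\}{0pt}{}{k}{m}\frac{n!}{(n-m-1)!}p^m} {\sqrt{n\sum\limits_{m=1}^k\sum\limits_{l=1}^k\genfrac\{\}{0pt}{}{k}{m}\genfrac\{\}{0pt}{}{k}{l} \Big(ml(np)^{m+l-1}(1-p)+\sum\limits_{s=1}^{\min\{m,l\}}\frac{m!\,l!\,(np)^{m+l-s}(1-p^s)}{s!(m-s)!(l-s)!}\Big)}}$$ converges in distribution to the standard normal distribution $N(0,1)$ as $n\to\infty$. Conversely, if $(Z^{(k)}_n - a_n)/b_n$ converges in distribution to $N(0, 1)$ as $n\to\infty$ for some (deterministic, real) constants $a_n$ and $b_n$, then $n^2p(1-p)\to\infty$.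
   Context: $G(n,p)$ is the Erdős–Rényi random graph on the vertex set $\{1,\dots,n\}$, in which each possible edge is present independently with probability $p$, where $0<p<1$ and $p=p(n)$ may depend on $n$. $I_{ij}$ is the indicator of the event that there is an edge between $i$ and $j$ (so $I_{ii}=0$, $I_{ij}=I_{ji}$). For an integer $k\ge1$, the $k$-th order generalized Zagreb index is $Z_n^{(k)}=\sum_{i=1}^n\big(\sum_{j=1}^n I_{ij}\big)^k$, the sum of the $k$-th powers of the vertex degrees. $\genfrac\{\}{0pt}{}{k}{m}$ denotes the Stirling number of the second kind. *)

theory Defs
  imports "HOL-Probability.Probability" "HOL-Combinatorics.Stirling"
begin

definition possible_edges :: "nat \<Rightarrow> nat set set" where
  "possible_edges n = {e. e \<subseteq> {1..n} \<and> card e = 2}"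

text \<open>
  A graph on the vertex set \<open>{1..n}\<close> is its set of edges. In the random graph the indicators
  \<open>f e\<close> of the possible edges are independent Bernoulli variables; an \<open>f\<close> drawn from
  \<open>Pi_pmf\<close> is \<open>False\<close> outside the possible edges.
\<close>
definition gnp :: "nat \<Rightarrow> real \<Rightarrow> nat set set pmf" where
  "gnp n p = map_pmf (\<lambda>f. {e. f e}) (Pi_pmf (possible_edges n) False (\<lambda>_. bernoulli_pmf p))"

text \<open>For \<open>i = j\<close> this is 0, because the singleton \<open>{i}\<close> is not a possible edge.\<close>
definition edge_ind :: "nat set set \<Rightarrow> nat \<Rightarrow> nat \<Rightarrow> real" where
  "edge_ind G i j = of_bool ({i, j} \<in> G)"

definition zagreb :: "nat \<Rightarrow> nat \<Rightarrow> nat set set \<Rightarrow> real" where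
  "zagreb k n G = (\<Sum>i=1..n. (\<Sum>j=1..n. edge_ind G i j) ^ k)"

text \<open>
  The quotient \<open>n! / (n - m - 1)!\<close>, i.e. \<open>n (n - 1) \<dots> (n - m)\<close>, with the usual convention that
  it is 0 if \<open>n - m - 1\<close> is negative (natural number subtraction would truncate).
\<close>
definition fact_quot :: "nat \<Rightarrow> nat \<Rightarrow> real" where
  "fact_quot n m = (if m < n then fact n / fact (n - m - 1) else 0)"

definition zagreb_center :: "nat \<Rightarrow> nat \<Rightarrow> real \<Rightarrow> real" where
  "zagreb_center k n p = (\<Sum>m=1..k. real (Stirling k m) * fact_quot n m * p ^ m)"

definition zagreb_scale :: "nat \<Rightarrow> nat \<Rightarrow> real \<Rightarrow> real" where
  "zagreb_scale k n p = sqrt (real n *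
     (\<Sum>m=1..k. \<Sum>l=1..k. real (Stirling k m) * real (Stirling k l) *
        (real m * real l * (real n * p) ^ (m + l - 1) * (1 - p) +
         (\<Sum>s=1..min m l. fact m * fact l * (real n * p) ^ (m + l - s) * (1 - p ^ s) /
                          (fact s * fact (m - s) * fact (l - s))))))"

end

theory Submission
  imports Defs "HOL-Real_Asymp.Real_Asymp"
begin

text \<open>
  The central limit theorem is proved by the Stein-Tikhomirov method, uniformly in \<open>p\<close>. With \<open>W\<close> the
  normalized index, a discrete second-order Poincare inequality for functions of independent
  Bernoulli variables bounds \<open>E W h(s W) - s E h'(s W)\<close> for \<open>h = sin\<close> and \<open>h = cos\<close> by fourth moments
  of the first and second differences of the index. Toggling an edge changes the index by an amount
  of order \<open>\<lambda> ^ (k - 1)\<close>, where \<open>\<lambda> = 1 + n p\<close>, and toggling a second edge changes that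
  amount only if the edges share a vertex, and then by order \<open>\<lambda> ^ (k - 2)\<close>. Since the variance is at
  least of order \<open>n\<^sup>2 p (1 - p) \<lambda> ^ (2 k - 2)\<close>, the error is of order \<open>(n\<^sup>2 p (1 - p)) ^ (-1/2)\<close>. Hence the
  characteristic function nearly solves \<open>u' + s u = 0\<close> and converges to \<open>exp (- t\<^sup>2 / 2)\<close>.

  Conversely, if \<open>n\<^sup>2 p (1 - p)\<close> stays below \<open>C\<close> for infinitely many \<open>n\<close>, then for these \<open>n\<close> the empty
  or the complete graph has probability at least \<open>exp (- 4 C)\<close>. So the distribution of the index has
  an atom of that mass, which no sequence converging to a continuous law can have.
\<close>

section \<open>Expectations over a random subset\<close>

text \<open>Falling factorials of a binomial variable have monomial means, so expanding
  \<open>d ^ k\<close> in them by Stirling numbers makes the mean and all covariances exact finite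
  sums. The centre is then the exact mean, whereas the square of the scale only dominates the
  variance, with a ratio that tends to 1 at a rate free of \<open>p\<close>; this gap is carried as
  a separate error term. The obstacle is the range of \<open>p\<close>: \<open>n p\<close> may
  vanish, stay bounded or diverge, and \<open>1 - p\<close> may vanish. Hence
  \<open>p (1 - p)\<close> is kept as a factor in the covariance formula, and sizes are measured by
  \<open>1 + n p\<close> instead of \<open>n p\<close>. An edge has of order \<open>n\<close>
  adjacent edges; multiplied by \<open>p (1 - p)\<close> this is at most of order
  \<open>1 + n p\<close>, which is what a second difference gains over a first one. Fourth moments
  come in because squares of products of two differences are averaged. With sin and cos as the only
  test functions, no solution of a Stein equation has to be estimated.\<close>

definition random_subset :: "real \<Rightarrow> 'e set \<Rightarrow> 'e set pmf" where
  "random_subset p E = map_pmf (\<lambda>f. {e. f e}) (Pi_pmf E False (\<lambda>_. bernoulli_pmf p))"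

text \<open>The ground set is an argument, of arbitrary element type, so that statements can be
  proved by removing one edge at a time. For finite \<open>E\<close> the distribution has finite
  support, which settles integrability.\<close>

definition bexp :: "real \<Rightarrow> 'e set \<Rightarrow> ('e set \<Rightarrow> real) \<Rightarrow> real" where
  "bexp p E F = measure_pmf.expectation (random_subset p E) F"

text \<open>The analogue of a partial derivative in the indicator of \<open>e\<close>. Its value
  does not depend on whether \<open>e\<close> lies in \<open>A\<close>, so differencing twice in the
  same \<open>e\<close> gives 0.\<close>

definition discrete_deriv :: "'e \<Rightarrow> ('e set \<Rightarrow> real) \<Rightarrow> 'e set \<Rightarrow> real" where
  "discrete_deriv e F A = F (insert e A) - F (A - {e})"

text \<open>The conditional expectation given the part of the random set outside \<open>S\<close>:
  what \<open>A\<close> contains of \<open>S\<close> is forgotten and resampled.\<close>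

definition partial_avg :: "real \<Rightarrow> 'e set \<Rightarrow> ('e set \<Rightarrow> real) \<Rightarrow> 'e set \<Rightarrow> real" where
  "partial_avg p S F A = bexp p S (\<lambda>B. F ((A - S) \<union> B))"

definition bcov :: "real \<Rightarrow> 'e set \<Rightarrow> ('e set \<Rightarrow> real) \<Rightarrow> ('e set \<Rightarrow> real) \<Rightarrow> real" where
  "bcov p E F G = bexp p E (\<lambda>A. F A * G A) - bexp p E F * bexp p E G"

lemma gnp_eq_random_subset: "gnp n p = random_subset p (possible_edges n)"
  by (simp add: gnp_def random_subset_def)

lemma set_random_subset_subset: "finite E \<Longrightarrow> set_pmf (random_subset p E) \<subseteq> Pow E"
  by (auto simp: random_subset_def set_Pi_pmf PiE_dflt_def)

lemma random_subset_insert: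
  assumes "finite E" "x \<notin> E"
  shows "random_subset p (insert x E) =
    bernoulli_pmf p \<bind> (\<lambda>b. map_pmf (\<lambda>A. if b then insert x A else A) (random_subset p E))"
proof -
  \<comment> \<open>A drawn \<open>f\<close> is \<open>False\<close> off \<open>E\<close>, hence at
    \<open>x\<close>; overwriting it there with \<open>False\<close> leaves the set
    unchanged.\<close>
  have *: "{e. (f(x := b)) e} = (if b then insert x {e. f e} else {e. f e})"
    if "f \<in> set_pmf (Pi_pmf E False (\<lambda>_. bernoulli_pmf p))" for f b
    using that assms by (auto simp: set_Pi_pmf PiE_dflt_def)
  show ?thesis
    unfolding random_subset_def Pi_pmf_insert'[OF assms]
    by (simp add: map_bind_pmf pmf.map_comp o_def map_pmf_def[symmetric])
       (intro bind_pmf_cong map_pmf_cong refl, metis *)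
qed

lemma finite_set_random_subset: "finite E \<Longrightarrow> finite (set_pmf (random_subset p E))"
  by (rule finite_subset[OF set_random_subset_subset]) auto

lemma bexp_cong:
  assumes "finite E" "\<And>A. A \<subseteq> E \<Longrightarrow> F A = G A"
  shows "bexp p E F = bexp p E G"
  unfolding bexp_def using set_random_subset_subset[OF assms(1), of p] assms(2)
  by (intro Bochner_Integration.integral_cong_AE) (auto simp: AE_measure_pmf_iff)

lemma bexp_empty [simp]: "bexp p {} F = F {}"
  by (simp add: bexp_def random_subset_def)

lemma bexp_const [simp]: "bexp p E (\<lambda>_. c) = c"
  by (simp add: bexp_def)

lemma bexp_add:
  assumes "finite E" shows "bexp p E (\<lambda>A. F A + G A) = bexp p E F + bexp p E G"
  unfolding bexp_def using finite_set_random_subset[OF assms]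
  by (intro Bochner_Integration.integral_add integrable_measure_pmf_finite)

lemma bexp_diff:
  assumes "finite E" shows "bexp p E (\<lambda>A. F A - G A) = bexp p E F - bexp p E G"
  unfolding bexp_def using finite_set_random_subset[OF assms]
  by (intro Bochner_Integration.integral_diff integrable_measure_pmf_finite)

lemma bexp_cmult: "bexp p E (\<lambda>A. c * F A) = c * bexp p E F"
  by (simp add: bexp_def)

lemma bexp_multc: "bexp p E (\<lambda>A. F A * c) = bexp p E F * c"
  by (simp add: bexp_def)

lemma bexp_sum:
  assumes "finite E" shows "bexp p E (\<lambda>A. \<Sum>i\<in>I. F i A) = (\<Sum>i\<in>I. bexp p E (F i))"
  unfolding bexp_def using finite_set_random_subset[OF assms]
  by (intro Bochner_Integration.integral_sum integrable_measure_pmf_finite)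

lemma bexp_mono:
  assumes "finite E" "\<And>A. A \<subseteq> E \<Longrightarrow> F A \<le> G A"
  shows "bexp p E F \<le> bexp p E G"
  unfolding bexp_def using set_random_subset_subset[OF assms(1), of p] assms(2) finite_set_random_subset[OF assms(1)]
  by (intro integral_mono_AE) (auto simp: AE_measure_pmf_iff intro: integrable_measure_pmf_finite)

lemma bexp_nonneg:
  assumes "finite E" "\<And>A. A \<subseteq> E \<Longrightarrow> 0 \<le> F A"
  shows "0 \<le> bexp p E F"
  using bexp_mono[OF assms(1), of "\<lambda>_. 0" F p] assms(2) by simp

lemma bexp_abs_le: "finite E \<Longrightarrow> \<bar>bexp p E F\<bar> \<le> bexp p E (\<lambda>A. \<bar>F A\<bar>)"
  unfolding bexp_def by (rule integral_abs_bound)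

text \<open>Conditioning on one element. Together with \<open>bexp_empty\<close> this recursion
  determines the operator, and the inductions over the ground set below use it instead of the
  distribution.\<close>

lemma bexp_insert:
  assumes "finite E" "x \<notin> E" "0 \<le> p" "p \<le> 1"
  shows "bexp p (insert x E) F = p * bexp p E (\<lambda>A. F (insert x A)) + (1 - p) * bexp p E F"
proof -
  have "bexp p (insert x E) F =
      measure_pmf.expectation (bernoulli_pmf p)
        (\<lambda>b. measure_pmf.expectation (map_pmf (\<lambda>A. if b then insert x A else A) (random_subset p E)) F)"
    unfolding bexp_def random_subset_insert[OF assms(1,2)] using finite_set_random_subset[OF assms(1)]
    by (subst pmf_expectation_bind[where A = UNIV]) (auto simp: integral_measure_pmf[where A=UNIV])
  then show ?thesis
    using assms(3,4) by (simp add: bexp_def)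
qed

text \<open>Jensen for the square, from the nonnegative second moment of \<open>F\<close> minus its
  mean; applied twice it gives the fourth power.\<close>

lemma bexp_sq_le:
  assumes "finite E" shows "(bexp p E F)\<^sup>2 \<le> bexp p E (\<lambda>A. (F A)\<^sup>2)"
proof -
  let ?m = "bexp p E F"
  have "0 \<le> bexp p E (\<lambda>A. (F A - ?m)\<^sup>2)" by (intro bexp_nonneg assms) auto
  also have "(\<lambda>A. (F A - ?m)\<^sup>2) = (\<lambda>A. ((F A)\<^sup>2 - (2 * ?m) * F A) + ?m\<^sup>2)"
    by (auto simp: power2_eq_square algebra_simps)
  also have "bexp p E \<dots> = bexp p E (\<lambda>A. (F A)\<^sup>2) - ?m\<^sup>2"
    by (simp add: bexp_add bexp_diff bexp_cmult assms power2_eq_square)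
  finally show ?thesis by simp
qed

lemma bexp_pow4_le:
  assumes "finite E" shows "(bexp p E F) ^ 4 \<le> bexp p E (\<lambda>A. (F A) ^ 4)"
proof -
  have "(bexp p E F) ^ 4 = ((bexp p E F)\<^sup>2)\<^sup>2" by simp
  also have "\<dots> \<le> (bexp p E (\<lambda>A. (F A)\<^sup>2))\<^sup>2"
    by (intro power_mono bexp_sq_le assms) auto
  also have "\<dots> \<le> bexp p E (\<lambda>A. ((F A)\<^sup>2)\<^sup>2)" by (rule bexp_sq_le[OF assms])
  finally show ?thesis by simp
qed

lemma bexp_abs_le_sqrt:
  assumes "finite E" shows "bexp p E (\<lambda>A. \<bar>F A\<bar>) \<le> sqrt (bexp p E (\<lambda>A. (F A)\<^sup>2))"
  using bexp_sq_le[OF assms, of p "\<lambda>A. \<bar>F A\<bar>"] by (simp add: real_le_rsqrt)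

section \<open>Independence, conditional averages and the covariance identity\<close>

context
  fixes p :: real
  assumes p: "0 \<le> p" "p \<le> 1"
begin

lemma bexp_union:
  assumes "finite S" "finite T" "S \<inter> T = {}"
  shows "bexp p (S \<union> T) F = bexp p S (\<lambda>A. bexp p T (\<lambda>B. F (A \<union> B)))"
  using assms
proof (induction S arbitrary: F rule: finite_induct)
  case (insert x S)
  then show ?case by (simp add: bexp_insert p)
qed simp

lemma bexp_split:
  assumes "finite E" "S \<subseteq> E"
  shows "bexp p E F = bexp p (E - S) (\<lambda>A. bexp p S (\<lambda>B. F (A \<union> B)))"
  using bexp_union[of "E - S" S F] assms by (simp add: Un_absorb2 finite_subset Un_commute Diff_Int_distrib2)

text \<open>The elements outside \<open>S\<close> are separated by \<open>bexp_split\<close> and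
  then no longer occur in the integrand.\<close>

lemma bexp_marginal:
  assumes "finite E" "S \<subseteq> E"
  shows "bexp p E (\<lambda>A. F (A \<inter> S)) = bexp p S F"
proof -
  have fS: "finite S" using assms by (auto intro: finite_subset)
  have "bexp p E (\<lambda>A. F (A \<inter> S)) = bexp p (E - S) (\<lambda>A. bexp p S (\<lambda>B. F ((A \<union> B) \<inter> S)))"
    by (rule bexp_split[OF assms])
  also have "\<dots> = bexp p (E - S) (\<lambda>A. bexp p S F)"
  proof (intro bexp_cong, use assms fS in simp_all)
    fix A B assume "A \<subseteq> E - S" "B \<subseteq> S"
    then have "(A \<union> B) \<inter> S = B" by auto
    then show "F ((A \<union> B) \<inter> S) = F B" by simp
  qed
  finally show ?thesis by simp
qed

lemma bexp_indep:
  assumes "finite E" "S \<subseteq> E" "T \<subseteq> E" "S \<inter> T = {}"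
  shows "bexp p E (\<lambda>A. F (A \<inter> S) * G (A \<inter> T)) = bexp p S F * bexp p T G"
proof -
  have f: "finite S" "finite T" using assms by (auto intro: finite_subset)
  have "bexp p E (\<lambda>A. F (A \<inter> S) * G (A \<inter> T)) = bexp p E (\<lambda>A. (\<lambda>C. F (C \<inter> S) * G (C \<inter> T)) (A \<inter> (S \<union> T)))"
    by (intro bexp_cong assms) (auto simp: Int_assoc Int_absorb1 Un_Int_distrib2)
  also have "\<dots> = bexp p (S \<union> T) (\<lambda>C. F (C \<inter> S) * G (C \<inter> T))"
    using assms by (intro bexp_marginal) auto
  also have "\<dots> = bexp p S (\<lambda>A. bexp p T (\<lambda>B. F ((A \<union> B) \<inter> S) * G ((A \<union> B) \<inter> T)))"
    using f assms by (intro bexp_union) auto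
  also have "\<dots> = bexp p S (\<lambda>A. bexp p T (\<lambda>B. F A * G B))"
  proof (intro bexp_cong, use f in simp_all)
    fix A B assume "A \<subseteq> S" "B \<subseteq> T"
    then have "(A \<union> B) \<inter> S = A" "(A \<union> B) \<inter> T = B" using assms by auto
    then show "F ((A \<union> B) \<inter> S) * G ((A \<union> B) \<inter> T) = F A * G B" by simp
  qed
  also have "\<dots> = bexp p S F * bexp p T G" by (simp add: bexp_cmult bexp_multc)
  finally show ?thesis .
qed

lemma bexp_partial_avg:
  assumes "finite E" "S \<subseteq> E"
  shows "bexp p E (partial_avg p S F) = bexp p E F"
proof -
  have fS: "finite S" using assms by (auto intro: finite_subset)
  have "bexp p E (partial_avg p S F) = bexp p (E - S) (\<lambda>A. bexp p S (\<lambda>B. partial_avg p S F (A \<union> B)))"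
    by (rule bexp_split[OF assms])
  also have "\<dots> = bexp p (E - S) (\<lambda>A. bexp p S (\<lambda>B. bexp p S (\<lambda>B. F (A \<union> B))))"
  proof (intro bexp_cong, use assms fS in simp_all)
    fix A B assume "A \<subseteq> E - S" "B \<subseteq> S"
    then have "(A \<union> B) - S = A" by auto
    then show "partial_avg p S F (A \<union> B) = bexp p S (\<lambda>B. F (A \<union> B))" by (simp add: partial_avg_def)
  qed
  also have "\<dots> = bexp p E F" by (simp add: bexp_split[OF assms])
  finally show ?thesis .
qed

lemma bexp_partial_avg_pow4_le:
  assumes "finite E" "S \<subseteq> E"
  shows "bexp p E (\<lambda>A. partial_avg p S F A ^ 4) \<le> bexp p E (\<lambda>A. F A ^ 4)"
proof -
  have "bexp p E (\<lambda>A. partial_avg p S F A ^ 4) \<le> bexp p E (partial_avg p S (\<lambda>A. F A ^ 4))"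
    using assms finite_subset by (intro bexp_mono) (auto simp: partial_avg_def intro!: bexp_pow4_le)
  then show ?thesis by (simp add: bexp_partial_avg assms)
qed

lemma bexp_partial_avg_sq_le:
  assumes "finite E" "S \<subseteq> E"
  shows "bexp p E (\<lambda>A. (partial_avg p S F A)\<^sup>2) \<le> bexp p E (\<lambda>A. (F A)\<^sup>2)"
proof -
  have "bexp p E (\<lambda>A. (partial_avg p S F A)\<^sup>2) \<le> bexp p E (partial_avg p S (\<lambda>A. (F A)\<^sup>2))"
    using assms finite_subset by (intro bexp_mono) (auto simp: partial_avg_def intro!: bexp_sq_le)
  then show ?thesis by (simp add: bexp_partial_avg assms)
qed

text \<open>Adding or removing \<open>e\<close> commutes with resampling \<open>S\<close> unless
  \<open>e\<close> itself is resampled, in which case the average has forgotten it. Through this,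
  second differences of \<open>F\<close> control first differences of its conditional
  averages.\<close>

lemma discrete_deriv_partial_avg:
  assumes "finite S" 
  shows "discrete_deriv e (partial_avg p S F) A = (if e \<in> S then 0 else partial_avg p S (discrete_deriv e F) A)"
proof (cases "e \<in> S")
  case True
  then have "insert e A - S = A - S" "A - {e} - S = A - S" by auto
  with True show ?thesis by (simp add: discrete_deriv_def partial_avg_def)
next
  case False
  have "partial_avg p S (discrete_deriv e F) A = bexp p S (\<lambda>B. F ((insert e A - S) \<union> B) - F ((A - {e} - S) \<union> B))"
    unfolding partial_avg_def
  proof (rule bexp_cong[OF assms])
    fix B assume "B \<subseteq> S"
    then have "insert e (A - S \<union> B) = (insert e A - S) \<union> B" "(A - S \<union> B) - {e} = (A - {e} - S) \<union> B"
      using False by auto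
    then show "discrete_deriv e F (A - S \<union> B) = F ((insert e A - S) \<union> B) - F ((A - {e} - S) \<union> B)"
      by (simp add: discrete_deriv_def)
  qed
  then show ?thesis using False assms by (simp add: discrete_deriv_def partial_avg_def bexp_diff)
qed

text \<open>
  Revealing the elements of \<open>E\<close> one at a time writes \<open>F - E F\<close> as a sum of martingale differences;
  \<open>S j\<close> is the set of elements that are still averaged out when \<open>j\<close> is revealed. It depends on the
  enumeration only, not on \<open>F\<close> and \<open>G\<close>.
\<close>
lemma covariance_identity:
  assumes "finite E"
  shows "\<exists>S. (\<forall>j\<in>E. S j \<subseteq> E) \<and>
    (\<forall>F G. bcov p E F G = p * (1 - p) * (\<Sum>j\<in>E. bexp p E (\<lambda>A. partial_avg p (S j) (discrete_deriv j F) A * discrete_deriv j G A)))"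
  using assms
proof (induction E rule: finite_induct)
  case empty
  then show ?case by (simp add: bcov_def)
next
  case (insert x E)
  then obtain S where S: "\<And>j. j \<in> E \<Longrightarrow> S j \<subseteq> E"
    and cov: "\<And>F G. bcov p E F G = p * (1 - p) * (\<Sum>j\<in>E. bexp p E (\<lambda>A. partial_avg p (S j) (discrete_deriv j F) A * discrete_deriv j G A))"
    by blast
  \<comment> \<open>The element inserted last is revealed first: all of \<open>E\<close> is still
    averaged out when \<open>x\<close> is known. The sets of the older elements stay valid because
    they avoid \<open>x\<close>.\<close>
  define S' where "S' = S(x := E)"
  have fS: "finite (S j)" if "j \<in> E" for j using S[OF that] insert.hyps finite_subset by auto
  have "bcov p (insert x E) F G =
    p * (1 - p) * (\<Sum>j\<in>insert x E. bexp p (insert x E) (\<lambda>A. partial_avg p (S' j) (discrete_deriv j F) A * discrete_deriv j G A))" for F G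
  proof -
    define F1 where "F1 = (\<lambda>A. F (insert x A))"
    define G1 where "G1 = (\<lambda>A. G (insert x A))"
    have dd1: "discrete_deriv j H (insert x A) = discrete_deriv j (\<lambda>A. H (insert x A)) A" if "j \<in> E" for j H A
    proof -
      have "x \<noteq> j" using that insert.hyps by auto
      then have "insert x A - {j} = insert x (A - {j})" by auto
      then show ?thesis by (simp add: discrete_deriv_def insert_commute)
    qed
    have avg1: "partial_avg p (S j) (discrete_deriv j F) (insert x A) = partial_avg p (S j) (discrete_deriv j F1) A" if "j \<in> E" for j A
      unfolding partial_avg_def
    proof (intro bexp_cong fS that)
      fix B
      have "x \<notin> S j" using S[OF that] insert.hyps by auto
      then have *: "insert x A - S j \<union> B = insert x (A - S j \<union> B)" by auto
      show "discrete_deriv j F (insert x A - S j \<union> B) = discrete_deriv j F1 (A - S j \<union> B)"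
        unfolding * dd1[OF that] F1_def ..
    qed
    have 1: "bexp p (insert x E) (\<lambda>A. partial_avg p (S' j) (discrete_deriv j F) A * discrete_deriv j G A) =
        p * bexp p E (\<lambda>A. partial_avg p (S j) (discrete_deriv j F1) A * discrete_deriv j G1 A)
        + (1 - p) * bexp p E (\<lambda>A. partial_avg p (S j) (discrete_deriv j F) A * discrete_deriv j G A)" if "j \<in> E" for j
    proof -
      have "j \<noteq> x" using that insert.hyps by auto
      then show ?thesis
        using insert.hyps p that by (simp add: bexp_insert avg1 dd1 S'_def G1_def)
    qed
    \<comment> \<open>With all of \<open>E\<close> averaged out, the difference in \<open>x\<close>
      is a constant, the gap between the two conditional means of \<open>F\<close> given the state
      of \<open>x\<close>.\<close>
    have a: "partial_avg p E (discrete_deriv x F) A = bexp p E F1 - bexp p E F" if "A \<subseteq> insert x E" for A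
    proof -
      have "partial_avg p E (discrete_deriv x F) A = bexp p E (\<lambda>B. F1 B - F B)"
        unfolding partial_avg_def
      proof (intro bexp_cong insert.hyps)
        fix B assume "B \<subseteq> E"
        then have "insert x (A - E \<union> B) = insert x B" "A - E \<union> B - {x} = B"
          using that insert.hyps by auto
        then show "discrete_deriv x F (A - E \<union> B) = F1 B - F B" by (simp add: discrete_deriv_def F1_def)
      qed
      then show ?thesis by (simp add: bexp_diff insert.hyps)
    qed
    have g: "discrete_deriv x G A = G1 A - G A" "discrete_deriv x G (insert x A) = G1 A - G A" if "A \<subseteq> E" for A
    proof -
      have "A - {x} = A" using that insert.hyps by auto
      then show "discrete_deriv x G A = G1 A - G A" "discrete_deriv x G (insert x A) = G1 A - G A"
        by (auto simp: discrete_deriv_def G1_def)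
    qed
    have "bexp p (insert x E) (\<lambda>A. partial_avg p E (discrete_deriv x F) A * discrete_deriv x G A) =
        bexp p (insert x E) (\<lambda>A. (bexp p E F1 - bexp p E F) * discrete_deriv x G A)"
      using insert.hyps by (intro bexp_cong) (auto simp: a)
    also have "\<dots> = (bexp p E F1 - bexp p E F) * bexp p (insert x E) (discrete_deriv x G)"
      by (rule bexp_cmult)
    also have "bexp p (insert x E) (discrete_deriv x G) = p * bexp p E (\<lambda>A. G1 A - G A) + (1 - p) * bexp p E (\<lambda>A. G1 A - G A)"
      using insert.hyps p by (auto simp: bexp_insert g intro!: arg_cong2[where f="(+)"] arg_cong2[where f="(*)"] bexp_cong)
    also have "\<dots> = bexp p E G1 - bexp p E G" using insert.hyps by (simp add: bexp_diff algebra_simps)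
    finally have 2: "bexp p (insert x E) (\<lambda>A. partial_avg p (S' x) (discrete_deriv x F) A * discrete_deriv x G A) =
        (bexp p E F1 - bexp p E F) * (bexp p E G1 - bexp p E G)" by (simp add: S'_def)
    \<comment> \<open>Law of total covariance: the mean conditional covariance plus the covariance
      of the two-valued conditional means, which carries the factor
      \<open>p * (1 - p)\<close>.\<close>
    have "bcov p (insert x E) F G = p * bcov p E F1 G1 + (1 - p) * bcov p E F G
        + p * (1 - p) * ((bexp p E F1 - bexp p E F) * (bexp p E G1 - bexp p E G))"
      using insert.hyps p by (simp add: bcov_def bexp_insert F1_def G1_def algebra_simps)
    also have "\<dots> = p * (1 - p) * (\<Sum>j\<in>insert x E. bexp p (insert x E) (\<lambda>A. partial_avg p (S' j) (discrete_deriv j F) A * discrete_deriv j G A))"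
      using insert.hyps by (simp add: cov 1 2 sum.distrib flip: sum_distrib_left) algebra
    finally show ?thesis .
  qed
  moreover have "\<forall>j\<in>insert x E. S' j \<subseteq> insert x E" using S by (auto simp: S'_def)
  ultimately show ?case by blast
qed

text \<open>The diagonal case of the covariance identity (Efron-Stein): AM-GM separates the two
  factors, and averaging does not increase second moments.\<close>

lemma poincare:
  assumes "finite E"
  shows "bcov p E F F \<le> p * (1 - p) * (\<Sum>j\<in>E. bexp p E (\<lambda>A. (discrete_deriv j F A)\<^sup>2))"
proof -
  obtain S where S: "\<And>j. j \<in> E \<Longrightarrow> S j \<subseteq> E"
    and cov: "\<And>F G. bcov p E F G = p * (1 - p) * (\<Sum>j\<in>E. bexp p E (\<lambda>A. partial_avg p (S j) (discrete_deriv j F) A * discrete_deriv j G A))"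
    using covariance_identity[OF assms] by blast
  have "bexp p E (\<lambda>A. partial_avg p (S j) (discrete_deriv j F) A * discrete_deriv j F A) \<le> bexp p E (\<lambda>A. (discrete_deriv j F A)\<^sup>2)" if "j \<in> E" for j
  proof -
    have "bexp p E (\<lambda>A. partial_avg p (S j) (discrete_deriv j F) A * discrete_deriv j F A)
      \<le> bexp p E (\<lambda>A. 1/2 * (partial_avg p (S j) (discrete_deriv j F) A)\<^sup>2 + 1/2 * (discrete_deriv j F A)\<^sup>2)"
    proof (intro bexp_mono assms)
      fix A
      show "partial_avg p (S j) (discrete_deriv j F) A * discrete_deriv j F A \<le> 1/2 * (partial_avg p (S j) (discrete_deriv j F) A)\<^sup>2 + 1/2 * (discrete_deriv j F A)\<^sup>2"
        using sum_squares_bound[of "partial_avg p (S j) (discrete_deriv j F) A" "discrete_deriv j F A"] by simp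
    qed
    also have "\<dots> = 1/2 * bexp p E (\<lambda>A. (partial_avg p (S j) (discrete_deriv j F) A)\<^sup>2) + 1/2 * bexp p E (\<lambda>A. (discrete_deriv j F A)\<^sup>2)"
      by (simp only: bexp_add[OF assms] bexp_cmult)
    also have "\<dots> \<le> bexp p E (\<lambda>A. (discrete_deriv j F A)\<^sup>2)"
      using bexp_partial_avg_sq_le[OF assms S[OF that], of "discrete_deriv j F"] by linarith
    finally show ?thesis .
  qed
  then show ?thesis unfolding cov using p by (intro mult_left_mono sum_mono) auto
qed

end

section \<open>A second-order Poincare inequality for normal approximation\<close>

text \<open>Cauchy-Schwarz for given bounds, by AM-GM with weights that turn each of the two halves
  into \<open>a\<^sup>2 * b\<^sup>2 / 2\<close>.\<close>

lemma bexp_sq_mult_le: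
  assumes "finite E" "0 < a" "0 < b"
    and "bexp p E (\<lambda>X. u X ^ 4) \<le> a ^ 4" "bexp p E (\<lambda>X. v X ^ 4) \<le> b ^ 4"
  shows "bexp p E (\<lambda>X. (u X)\<^sup>2 * (v X)\<^sup>2) \<le> a\<^sup>2 * b\<^sup>2"
proof -
  have "bexp p E (\<lambda>X. (u X)\<^sup>2 * (v X)\<^sup>2)
    \<le> bexp p E (\<lambda>X. (b\<^sup>2 / (2 * a\<^sup>2)) * u X ^ 4 + (a\<^sup>2 / (2 * b\<^sup>2)) * v X ^ 4)"
  proof (intro bexp_mono assms)
    fix X
    have "0 \<le> (b / a * (u X)\<^sup>2 - a / b * (v X)\<^sup>2)\<^sup>2" by simp
    also have "\<dots> = (b\<^sup>2 / a\<^sup>2) * u X ^ 4 + (a\<^sup>2 / b\<^sup>2) * v X ^ 4 - 2 * ((u X)\<^sup>2 * (v X)\<^sup>2)"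
      using assms by (simp add: power2_diff power_mult_distrib power_divide)
    finally show "(u X)\<^sup>2 * (v X)\<^sup>2 \<le> (b\<^sup>2 / (2 * a\<^sup>2)) * u X ^ 4 + (a\<^sup>2 / (2 * b\<^sup>2)) * v X ^ 4"
      by simp
  qed
  also have "\<dots> = (b\<^sup>2 / (2 * a\<^sup>2)) * bexp p E (\<lambda>X. u X ^ 4) + (a\<^sup>2 / (2 * b\<^sup>2)) * bexp p E (\<lambda>X. v X ^ 4)"
    by (simp only: bexp_add[OF assms(1)] bexp_cmult)
  also have "\<dots> \<le> (b\<^sup>2 / (2 * a\<^sup>2)) * a ^ 4 + (a\<^sup>2 / (2 * b\<^sup>2)) * b ^ 4"
    using assms by (intro add_mono mult_left_mono) auto
  also have "\<dots> = a\<^sup>2 * b\<^sup>2" using assms by (simp add: field_simps power4_eq_xxxx power2_eq_square)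
  finally show ?thesis .
qed

text \<open>A case of Hoelder: \<open>\<bar>u\<bar>\<close> is at most
  \<open>a / 2 + u\<^sup>2 / (2 * a)\<close>, and after multiplication by \<open>v\<^sup>2\<close>
  both parts have mean at most \<open>a ^ 3 / 2\<close>.\<close>

lemma bexp_abs_sq_le:
  assumes "finite E" "0 < a"
    and "bexp p E (\<lambda>X. u X ^ 4) \<le> a ^ 4" "bexp p E (\<lambda>X. v X ^ 4) \<le> a ^ 4"
  shows "bexp p E (\<lambda>X. \<bar>u X\<bar> * (v X)\<^sup>2) \<le> a ^ 3"
proof -
  have "(bexp p E (\<lambda>X. (v X)\<^sup>2))\<^sup>2 \<le> bexp p E (\<lambda>X. ((v X)\<^sup>2)\<^sup>2)" by (rule bexp_sq_le[OF assms(1)])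
  also have "\<dots> \<le> (a\<^sup>2)\<^sup>2" using assms by simp
  finally have v: "bexp p E (\<lambda>X. (v X)\<^sup>2) \<le> a\<^sup>2" by (rule power2_le_imp_le) auto
  have "bexp p E (\<lambda>X. \<bar>u X\<bar> * (v X)\<^sup>2)
    \<le> bexp p E (\<lambda>X. (a / 2) * (v X)\<^sup>2 + (1 / (2 * a)) * ((u X)\<^sup>2 * (v X)\<^sup>2))"
  proof (intro bexp_mono assms)
    fix X
    have "0 \<le> (a - \<bar>u X\<bar>)\<^sup>2" by simp
    then have "2 * a * \<bar>u X\<bar> \<le> a\<^sup>2 + (u X)\<^sup>2" by (simp add: power2_diff)
    then have "\<bar>u X\<bar> \<le> a / 2 + 1 / (2 * a) * (u X)\<^sup>2"
      using assms(2) by (simp add: field_simps power2_eq_square)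
    then have "\<bar>u X\<bar> * (v X)\<^sup>2 \<le> (a / 2 + 1 / (2 * a) * (u X)\<^sup>2) * (v X)\<^sup>2"
      by (intro mult_right_mono) auto
    then show "\<bar>u X\<bar> * (v X)\<^sup>2 \<le> (a / 2) * (v X)\<^sup>2 + (1 / (2 * a)) * ((u X)\<^sup>2 * (v X)\<^sup>2)"
      by (simp add: algebra_simps)
  qed
  also have "\<dots> = (a / 2) * bexp p E (\<lambda>X. (v X)\<^sup>2) + (1 / (2 * a)) * bexp p E (\<lambda>X. (u X)\<^sup>2 * (v X)\<^sup>2)"
    by (simp only: bexp_add[OF assms(1)] bexp_cmult)
  also have "\<dots> \<le> (a / 2) * a\<^sup>2 + (1 / (2 * a)) * (a\<^sup>2 * a\<^sup>2)"
    using assms v bexp_sq_mult_le[OF assms(1,2,2,3,4)] by (intro add_mono mult_left_mono) auto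
  also have "\<dots> = a ^ 3" using assms by (simp add: field_simps power3_eq_cube power2_eq_square)
  finally show ?thesis .
qed

text \<open>Discrete Leibniz rule. Expanded around \<open>A\<close> it has an extra product of
  differences, whose sign depends on whether \<open>A\<close> is the upper or the lower of the two
  points. Squaring removes the sign, and 3 is the price of splitting the square of three
  terms.\<close>

lemma discrete_deriv_mult_sq_le:
  "(discrete_deriv e (\<lambda>X. u X * v X) A)\<^sup>2 \<le>
    3 * ((discrete_deriv e u A)\<^sup>2 * (v A)\<^sup>2 + (u A)\<^sup>2 * (discrete_deriv e v A)\<^sup>2 + (discrete_deriv e u A)\<^sup>2 * (discrete_deriv e v A)\<^sup>2)"
proof -
  have 3: "(x + y + z)\<^sup>2 \<le> 3 * (x\<^sup>2 + y\<^sup>2 + z\<^sup>2)" for x y z :: real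
    using sum_squares_ge_zero[of "x - y" "y - z"] zero_le_square[of "x - z"]
    by (simp add: power2_eq_square algebra_simps)
  have "(discrete_deriv e (\<lambda>X. u X * v X) A)\<^sup>2 =
    (discrete_deriv e u A * v A + u A * discrete_deriv e v A + (if e \<in> A then -1 else 1) * (discrete_deriv e u A * discrete_deriv e v A))\<^sup>2"
    by (cases "e \<in> A") (simp_all add: discrete_deriv_def insert_absorb algebra_simps)
  also have "\<dots> \<le> 3 * ((discrete_deriv e u A * v A)\<^sup>2 + (u A * discrete_deriv e v A)\<^sup>2
      + ((if e \<in> A then -1 else 1) * (discrete_deriv e u A * discrete_deriv e v A))\<^sup>2)"
    by (rule 3)
  also have "\<dots> = 3 * ((discrete_deriv e u A)\<^sup>2 * (v A)\<^sup>2 + (u A)\<^sup>2 * (discrete_deriv e v A)\<^sup>2 + (discrete_deriv e u A)\<^sup>2 * (discrete_deriv e v A)\<^sup>2)"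
    by (simp add: power_mult_distrib)
  finally show ?thesis .
qed

lemma discrete_deriv_sum: "discrete_deriv e (\<lambda>X. \<Sum>i\<in>I. f i X) A = (\<Sum>i\<in>I. discrete_deriv e (f i) A)"
  by (simp add: discrete_deriv_def sum_subtractf)

lemma discrete_deriv_cmult: "discrete_deriv e (\<lambda>X. c * f X) A = c * discrete_deriv e f A"
  by (simp add: discrete_deriv_def algebra_simps)

text \<open>
  The covariance identity turns \<open>E (F - E F) g(F)\<close> into \<open>E T g'(F)\<close> up to second-order terms, where
  \<open>T\<close> has mean \<open>Var F\<close>; the Poincare inequality, applied to \<open>T\<close>, bounds the fluctuations of \<open>T\<close> by
  first and second differences of \<open>F\<close>.
\<close>
lemma stein_bound:
  fixes p a b M L1 L2 :: real and F :: "'e set \<Rightarrow> real" and g g' :: "real \<Rightarrow> real"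
  assumes fin: "finite E" and p: "0 \<le> p" "p \<le> 1"
    and ab: "0 < b" "b \<le> a"
    and dF: "\<And>j. j \<in> E \<Longrightarrow> bexp p E (\<lambda>X. discrete_deriv j F X ^ 4) \<le> a ^ 4"
    and ddF: "\<And>e j. e \<in> E \<Longrightarrow> j \<in> E \<Longrightarrow> bexp p E (\<lambda>X. discrete_deriv e (discrete_deriv j F) X ^ 4) \<le> b ^ 4"
    and nbr: "\<And>e. e \<in> E \<Longrightarrow> N e \<subseteq> E" "\<And>e. e \<in> E \<Longrightarrow> real (card (N e)) \<le> M"
    and zero: "\<And>e j X. e \<in> E \<Longrightarrow> j \<in> E - N e \<Longrightarrow> X \<subseteq> E \<Longrightarrow> discrete_deriv e (discrete_deriv j F) X = 0"
    and g: "\<And>x y. \<bar>g y - g x - g' x * (y - x)\<bar> \<le> L2 * (y - x)\<^sup>2" "\<And>x. \<bar>g' x\<bar> \<le> L1"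
  shows "\<bar>bexp p E (\<lambda>X. (F X - bexp p E F) * g (F X)) - bcov p E F F * bexp p E (\<lambda>X. g' (F X))\<bar>
    \<le> L1 * (3 * (p * (1 - p) * M * a * b) * sqrt (p * (1 - p) * real (card E)))
      + L2 * (p * (1 - p) * real (card E) * a ^ 3)"
proof -
  define r where "r = p * (1 - p)"
  have r: "0 \<le> r" using p by (simp add: r_def)
  have a: "0 < a" using ab by simp
  have L1: "0 \<le> L1" using g(2)[of 0] by simp
  have L2: "0 \<le> L2" using g(1)[of 1 0] by simp
  obtain S where S: "\<And>j. j \<in> E \<Longrightarrow> S j \<subseteq> E"
    and cov: "\<And>F G. bcov p E F G = r * (\<Sum>j\<in>E. bexp p E (\<lambda>A. partial_avg p (S j) (discrete_deriv j F) A * discrete_deriv j G A))"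
    using covariance_identity[OF p fin] unfolding r_def by blast
  have fS: "finite (S j)" if "j \<in> E" for j using S[OF that] fin finite_subset by auto
  \<comment> \<open>The conditional mean of the \<open>j\<close>-th difference given the elements
    outside \<open>S j\<close>; fourth moment bounds for differences of \<open>F\<close> pass to it
    because averaging is a contraction.\<close>
  define U where "U = (\<lambda>j. partial_avg p (S j) (discrete_deriv j F))"
  have dU: "discrete_deriv e (U j) X = (if e \<in> S j then 0 else partial_avg p (S j) (discrete_deriv e (discrete_deriv j F)) X)"
    if "j \<in> E" for e j X
    unfolding U_def by (rule discrete_deriv_partial_avg[OF p fS[OF that]])
  have U4: "bexp p E (\<lambda>X. U j X ^ 4) \<le> a ^ 4" if "j \<in> E" for j
    unfolding U_def using bexp_partial_avg_pow4_le[OF p fin S[OF that], of "discrete_deriv j F"] dF[OF that] by linarith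
  have dU4: "bexp p E (\<lambda>X. discrete_deriv e (U j) X ^ 4) \<le> b ^ 4" if "j \<in> E" "e \<in> E" for e j
    using bexp_partial_avg_pow4_le[OF p fin S[OF that(1)], of "discrete_deriv e (discrete_deriv j F)"] ddF[OF that(2,1)] that ab
    by (cases "e \<in> S j") (simp_all add: dU)
  have dU0: "discrete_deriv e (U j) X = 0" if "e \<in> E" "j \<in> E - N e" "X \<subseteq> E" for e j X
  proof -
    have "partial_avg p (S j) (discrete_deriv e (discrete_deriv j F)) X = bexp p (S j) (\<lambda>_. 0)"
      unfolding partial_avg_def using that S[of j] by (intro bexp_cong fS) (auto intro!: zero)
    then show ?thesis using that by (simp add: dU)
  qed
  define T where "T = (\<lambda>X. r * (\<Sum>j\<in>E. U j X * discrete_deriv j F X))"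
  have ET: "bexp p E T = bcov p E F F"
    by (simp add: T_def cov bexp_cmult bexp_sum fin U_def)
  \<comment> \<open>Only \<open>j\<close> in \<open>N e\<close> contribute, so \<open>M\<close>
    appears twice, from Cauchy-Schwarz and from counting. The 9 is the 3 of the Leibniz bound times
    the three products in \<open>Q\<close>, each of mean at most
    \<open>(a * b)\<^sup>2\<close>.\<close>
  have dT: "bexp p E (\<lambda>X. (discrete_deriv e T X)\<^sup>2) \<le> 9 * (r * M * a * b)\<^sup>2" if e: "e \<in> E" for e
  proof -
    have N: "N e \<subseteq> E" "finite (N e)" "real (card (N e)) \<le> M" and M: "0 \<le> M"
      using nbr[OF e] fin by (auto intro: finite_subset)
    define Q where "Q = (\<lambda>j X. (discrete_deriv e (U j) X)\<^sup>2 * (discrete_deriv j F X)\<^sup>2 + (U j X)\<^sup>2 * (discrete_deriv e (discrete_deriv j F) X)\<^sup>2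
        + (discrete_deriv e (U j) X)\<^sup>2 * (discrete_deriv e (discrete_deriv j F) X)\<^sup>2)"
    have Q: "bexp p E (Q j) \<le> 3 * (a * b)\<^sup>2" if j: "j \<in> N e" for j
    proof -
      have jE: "j \<in> E" using j N by auto
      have "bexp p E (Q j) \<le> b\<^sup>2 * a\<^sup>2 + a\<^sup>2 * b\<^sup>2 + b\<^sup>2 * b\<^sup>2"
        unfolding Q_def bexp_add[OF fin] using ab a jE e
        by (intro add_mono bexp_sq_mult_le fin U4 dU4 dF ddF) auto
      also have "b\<^sup>2 * b\<^sup>2 \<le> a\<^sup>2 * b\<^sup>2" using ab by (intro mult_right_mono power_mono) auto
      finally show ?thesis by (simp add: power_mult_distrib)
    qed
    have "bexp p E (\<lambda>X. (discrete_deriv e T X)\<^sup>2) \<le> bexp p E (\<lambda>X. (r\<^sup>2 * M * 3) * (\<Sum>j\<in>N e. Q j X))"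
    proof (intro bexp_mono fin)
      fix X assume X: "X \<subseteq> E"
      have "discrete_deriv e T X = r * (\<Sum>j\<in>E. discrete_deriv e (\<lambda>X. U j X * discrete_deriv j F X) X)"
        unfolding T_def by (simp add: discrete_deriv_cmult discrete_deriv_sum)
      also have "(\<Sum>j\<in>E. discrete_deriv e (\<lambda>X. U j X * discrete_deriv j F X) X) = (\<Sum>j\<in>N e. discrete_deriv e (\<lambda>X. U j X * discrete_deriv j F X) X)"
      proof (intro sum.mono_neutral_right fin N ballI)
        fix j assume j: "j \<in> E - N e"
        have "(discrete_deriv e (\<lambda>X. U j X * discrete_deriv j F X) X)\<^sup>2 \<le> 0"
          using discrete_deriv_mult_sq_le[of e "U j" "discrete_deriv j F" X] dU0[OF e j X] zero[OF e j X] by simp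
        then show "discrete_deriv e (\<lambda>X. U j X * discrete_deriv j F X) X = 0" by simp
      qed
      finally have "(discrete_deriv e T X)\<^sup>2 = r\<^sup>2 * (\<Sum>j\<in>N e. discrete_deriv e (\<lambda>X. U j X * discrete_deriv j F X) X)\<^sup>2"
        by (simp add: power_mult_distrib)
      also have "\<dots> \<le> r\<^sup>2 * ((\<Sum>j\<in>N e. (discrete_deriv e (\<lambda>X. U j X * discrete_deriv j F X) X)\<^sup>2) * real (card (N e)))"
        by (intro mult_left_mono sum_squared_le_sum_of_squares N) auto
      also have "\<dots> \<le> r\<^sup>2 * ((\<Sum>j\<in>N e. 3 * Q j X) * M)"
        using N M unfolding Q_def
        by (intro mult_left_mono mult_mono sum_mono discrete_deriv_mult_sq_le) (auto intro!: sum_nonneg)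
      finally show "(discrete_deriv e T X)\<^sup>2 \<le> (r\<^sup>2 * M * 3) * (\<Sum>j\<in>N e. Q j X)"
        by (simp add: sum_distrib_left[symmetric] mult_ac)
    qed
    also have "\<dots> = (r\<^sup>2 * M * 3) * (\<Sum>j\<in>N e. bexp p E (Q j))"
      by (simp add: bexp_cmult bexp_sum fin)
    also have "\<dots> \<le> (r\<^sup>2 * M * 3) * (\<Sum>j\<in>N e. 3 * (a * b)\<^sup>2)"
      using M by (intro mult_left_mono sum_mono Q) auto
    also have "\<dots> = (r\<^sup>2 * M * 9 * (a * b)\<^sup>2) * real (card (N e))"
      by simp
    also have "\<dots> \<le> (r\<^sup>2 * M * 9 * (a * b)\<^sup>2) * M"
      using M N by (intro mult_left_mono) auto
    finally show ?thesis by (simp add: power2_eq_square mult_ac)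
  qed
  have "bexp p E (\<lambda>X. \<bar>T X - bexp p E T\<bar>) \<le> sqrt (bexp p E (\<lambda>X. (T X - bexp p E T)\<^sup>2))"
    by (rule bexp_abs_le_sqrt[OF fin])
  also have "bexp p E (\<lambda>X. (T X - bexp p E T)\<^sup>2) = bcov p E T T"
  proof -
    have "(\<lambda>X. (T X - bexp p E T)\<^sup>2) = (\<lambda>X. (T X * T X - (2 * bexp p E T) * T X) + (bexp p E T)\<^sup>2)"
      by (auto simp: power2_eq_square algebra_simps)
    then show ?thesis
      by (simp add: bcov_def bexp_add bexp_diff bexp_cmult fin power2_eq_square)
  qed
  also have "\<dots> \<le> r * (\<Sum>e\<in>E. bexp p E (\<lambda>X. (discrete_deriv e T X)\<^sup>2))"
    unfolding r_def by (rule poincare[OF p fin])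
  also have "\<dots> \<le> r * (\<Sum>e\<in>E. 9 * (r * M * a * b)\<^sup>2)"
    using r by (intro mult_left_mono sum_mono dT)
  also have "\<dots> = (3 * (r * M * a * b))\<^sup>2 * (r * real (card E))"
    by (simp add: power2_eq_square)
  also have "sqrt \<dots> = \<bar>3 * (r * M * a * b)\<bar> * sqrt (r * real (card E))"
    by (simp only: real_sqrt_mult real_sqrt_abs)
  also have "\<dots> = 3 * (r * M * a * b) * sqrt (r * real (card E))"
  proof (cases "E = {}")
    \<comment> \<open>\<open>M\<close> is known to be nonnegative only when some \<open>e\<close>
      exists; for empty \<open>E\<close> the root is 0.\<close>
    case False
    then obtain e where "e \<in> E" by auto
    then have "0 \<le> M" using nbr(2)[of e] by linarith
    then show ?thesis using r a ab by simp
  qed simp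
  finally have Tbound: "bexp p E (\<lambda>X. \<bar>T X - bexp p E T\<bar>)
      \<le> 3 * (r * M * a * b) * sqrt (r * real (card E))" by simp

  \<comment> \<open>The failure of the chain rule. Since \<open>F X\<close> is one of the two values
    being subtracted, Taylor's bound at \<open>F X\<close> applies whether or not \<open>j\<close>
    lies in \<open>X\<close>, up to sign.\<close>
  define R where "R = (\<lambda>j X. discrete_deriv j (\<lambda>X. g (F X)) X - g' (F X) * discrete_deriv j F X)"
  have R: "\<bar>R j X\<bar> \<le> L2 * (discrete_deriv j F X)\<^sup>2" for j X
  proof (cases "j \<in> X")
    case True
    then have "R j X = - (g (F (X - {j})) - g (F X) - g' (F X) * (F (X - {j}) - F X))"
      by (simp add: R_def discrete_deriv_def insert_absorb algebra_simps)
    then have "\<bar>R j X\<bar> \<le> L2 * (F (X - {j}) - F X)\<^sup>2" using g(1)[of "F (X - {j})" "F X"] by simp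
    then show ?thesis using True by (simp add: discrete_deriv_def insert_absorb power2_commute)
  next
    case False
    then show ?thesis using g(1)[of "F (insert j X)" "F X"] by (simp add: R_def discrete_deriv_def)
  qed
  have "bexp p E (\<lambda>X. (F X - bexp p E F) * g (F X)) = bcov p E F (\<lambda>X. g (F X))"
    by (simp add: bcov_def left_diff_distrib bexp_diff bexp_cmult fin)
  also have "\<dots> = r * (\<Sum>j\<in>E. bexp p E (\<lambda>X. U j X * discrete_deriv j F X * g' (F X) + U j X * R j X))"
    by (simp add: cov U_def R_def algebra_simps)
  also have "\<dots> = bexp p E (\<lambda>X. T X * g' (F X)) + r * (\<Sum>j\<in>E. bexp p E (\<lambda>X. U j X * R j X))"
    by (simp add: T_def bexp_add fin sum.distrib algebra_simps bexp_cmult bexp_sum sum_distrib_left)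
  \<comment> \<open>The variance cancels because it is the mean of \<open>T\<close>; what remains is
    the fluctuation of \<open>T\<close> and the Taylor remainders.\<close>
  finally have "bexp p E (\<lambda>X. (F X - bexp p E F) * g (F X)) - bcov p E F F * bexp p E (\<lambda>X. g' (F X))
      = bexp p E (\<lambda>X. (T X - bexp p E T) * g' (F X)) + r * (\<Sum>j\<in>E. bexp p E (\<lambda>X. U j X * R j X))"
    by (simp add: left_diff_distrib bexp_diff bexp_cmult fin ET)
  also have "\<bar>\<dots>\<bar> \<le> \<bar>bexp p E (\<lambda>X. (T X - bexp p E T) * g' (F X))\<bar>
      + \<bar>r * (\<Sum>j\<in>E. bexp p E (\<lambda>X. U j X * R j X))\<bar>"
    by (rule abs_triangle_ineq)
  also have "\<bar>bexp p E (\<lambda>X. (T X - bexp p E T) * g' (F X))\<bar>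
      \<le> bexp p E (\<lambda>X. \<bar>T X - bexp p E T\<bar> * L1)"
    using g(2) by (intro order_trans[OF bexp_abs_le] bexp_mono fin) (auto simp: abs_mult intro!: mult_left_mono)
  also have "\<dots> = L1 * bexp p E (\<lambda>X. \<bar>T X - bexp p E T\<bar>)" by (simp add: bexp_multc)
  also have "\<dots> \<le> L1 * (3 * (r * M * a * b) * sqrt (r * real (card E)))"
    using L1 by (intro mult_left_mono Tbound)
  also have "\<bar>r * (\<Sum>j\<in>E. bexp p E (\<lambda>X. U j X * R j X))\<bar> \<le> r * (\<Sum>j\<in>E. \<bar>bexp p E (\<lambda>X. U j X * R j X)\<bar>)"
    using r by (simp add: abs_mult mult_left_mono)
  also have "\<dots> \<le> r * (\<Sum>j\<in>E. L2 * a ^ 3)"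
  proof (intro mult_left_mono sum_mono r)
    fix j assume j: "j \<in> E"
    have "\<bar>bexp p E (\<lambda>X. U j X * R j X)\<bar> \<le> bexp p E (\<lambda>X. \<bar>U j X * R j X\<bar>)"
      by (rule bexp_abs_le[OF fin])
    also have "\<dots> \<le> bexp p E (\<lambda>X. L2 * (\<bar>U j X\<bar> * (discrete_deriv j F X)\<^sup>2))"
    proof (intro bexp_mono fin)
      fix X
      have "\<bar>U j X * R j X\<bar> \<le> \<bar>U j X\<bar> * (L2 * (discrete_deriv j F X)\<^sup>2)"
        unfolding abs_mult by (intro mult_left_mono R) auto
      then show "\<bar>U j X * R j X\<bar> \<le> L2 * (\<bar>U j X\<bar> * (discrete_deriv j F X)\<^sup>2)" by (simp add: mult_ac)
    qed
    also have "\<dots> = L2 * bexp p E (\<lambda>X. \<bar>U j X\<bar> * (discrete_deriv j F X)\<^sup>2)" by (rule bexp_cmult)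
    also have "\<dots> \<le> L2 * a ^ 3"
      using L2 by (intro mult_left_mono bexp_abs_sq_le fin a U4 dF j)
    finally show "\<bar>bexp p E (\<lambda>X. U j X * R j X)\<bar> \<le> L2 * a ^ 3" .
  qed
  finally show ?thesis unfolding r_def by (simp add: mult_ac)
qed

section \<open>Falling factorials and degrees\<close>

text \<open>The binomial form of \<open>d (d - 1) ... (d - m + 1)\<close> vanishes for
  \<open>m > d\<close> without any truncated subtraction.\<close>

definition falling_fact :: "nat \<Rightarrow> nat \<Rightarrow> real" where
  "falling_fact d m = fact m * real (d choose m)"

lemma falling_fact_0 [simp]: "falling_fact d 0 = 1"
  by (simp add: falling_fact_def)

lemma falling_fact_nonneg [simp]: "0 \<le> falling_fact d m"
  by (simp add: falling_fact_def)

lemma falling_fact_Suc_Suc: "falling_fact (Suc d) (Suc m) = falling_fact d (Suc m) + real (Suc m) * falling_fact d m"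
  by (simp add: falling_fact_def algebra_simps)

text \<open>The rule \<open>(d)_(m+1) = (d - m) (d)_m\<close>, arranged without subtraction so that
  it also covers \<open>m > d\<close>, where both sides vanish.\<close>

lemma falling_fact_mult: "real d * falling_fact d m = falling_fact d (Suc m) + real m * falling_fact d m"
proof (cases "m \<le> d")
  case True
  have "Suc m * (d choose Suc m) = (d - m) * (d choose m)"
    unfolding binomial_absorb_comp binomial_absorption ..
  then have "real (Suc m) * real (d choose Suc m) = (real d - real m) * real (d choose m)"
    using True by (metis of_nat_diff of_nat_mult)
  then have "fact m * (real (Suc m) * real (d choose Suc m)) = fact m * ((real d - real m) * real (d choose m))"
    by simp
  then show ?thesis by (simp add: falling_fact_def algebra_simps)
qed (simp add: falling_fact_def binomial_eq_0)

lemma falling_fact_fact: "m \<le> d \<Longrightarrow> falling_fact d m = fact d / fact (d - m)"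
  by (simp add: falling_fact_def binomial_fact)

lemma falling_fact_le: "falling_fact d m \<le> real d ^ m"
proof (induction m)
  case (Suc m)
  have "falling_fact d (Suc m) \<le> real d * falling_fact d m" using falling_fact_mult[of d m] by simp
  also have "\<dots> \<le> real d * real d ^ m" using Suc by (intro mult_left_mono) auto
  finally show ?case by simp
qed simp

lemma falling_fact_ge:
  assumes "m \<le> c" "c \<le> d" shows "(real d - real c) ^ m \<le> falling_fact d m"
  using assms(1)
proof (induction m)
  case (Suc m)
  have "(real d - real c) ^ Suc m \<le> (real d - real m) * falling_fact d m"
    using Suc assms unfolding power_Suc by (intro mult_mono) auto
  also have "\<dots> = falling_fact d (Suc m)" using falling_fact_mult[of d m] by (simp add: algebra_simps)
  finally show ?case .
qed simp

lemma power_eq_sum_Stirling: "real d ^ k = (\<Sum>m\<le>k. real (Stirling k m) * falling_fact d m)"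
proof (induction k)
  case (Suc k)
  have "(\<Sum>m\<le>Suc k. real (Stirling (Suc k) m) * falling_fact d m)
      = (\<Sum>m\<le>k. real (Stirling (Suc k) (Suc m)) * falling_fact d (Suc m))"
    by (subst sum.atMost_Suc_shift) simp
  also have "\<dots> = (\<Sum>m\<le>k. real (Stirling k m) * falling_fact d (Suc m))
      + (\<Sum>m\<le>k. real (Suc m) * real (Stirling k (Suc m)) * falling_fact d (Suc m))"
    by (simp add: sum.distrib[symmetric] algebra_simps)
  also have "(\<Sum>m\<le>k. real (Suc m) * real (Stirling k (Suc m)) * falling_fact d (Suc m))
      = (\<Sum>m\<le>Suc k. real m * real (Stirling k m) * falling_fact d m)"
    unfolding sum.atMost_Suc_shift[of _ k] by simp
  also have "\<dots> = (\<Sum>m\<le>k. real m * real (Stirling k m) * falling_fact d m)" by simp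
  also have "(\<Sum>m\<le>k. real (Stirling k m) * falling_fact d (Suc m)) + \<dots>
      = (\<Sum>m\<le>k. real (Stirling k m) * (real d * falling_fact d m))"
    by (simp add: falling_fact_mult sum.distrib[symmetric] algebra_simps)
  also have "\<dots> = real d ^ Suc k" by (simp add: Suc sum_distrib_left mult_ac)
  finally show ?case by simp
qed simp

lemma power_eq_sum_Stirling':
  assumes "1 \<le> k" shows "real d ^ k = (\<Sum>m=1..k. real (Stirling k m) * falling_fact d m)"
proof -
  have "(\<Sum>m\<le>k. real (Stirling k m) * falling_fact d m) = (\<Sum>m=1..k. real (Stirling k m) * falling_fact d m)"
  proof (rule sum.mono_neutral_right)
    show "\<forall>i\<in>{..k} - {1..k}. real (Stirling k i) * falling_fact d i = 0"
    proof
      fix i assume "i \<in> {..k} - {1..k}"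
      then have "i = 0" by auto
      then show "real (Stirling k i) * falling_fact d i = 0" using assms by (cases k) auto
    qed
  qed auto
  then show ?thesis by (simp add: power_eq_sum_Stirling)
qed

text \<open>Vandermonde's convolution, with \<open>s\<close> counting what an \<open>l\<close>-set
  shares with a fixed \<open>m\<close>-set; the remaining factors join to a falling factorial of
  order \<open>m + l - s\<close>. For \<open>m > x\<close> every term is 0, since
  \<open>m + l - s\<close> is at least \<open>m\<close>.\<close>

lemma falling_fact_prod:
  "falling_fact x m * falling_fact x l = (\<Sum>s\<le>min m l. fact m * fact l / (fact s * fact (m - s) * fact (l - s)) * falling_fact x (m + l - s))"
proof (cases "m \<le> x")
  case True
  have le: "{s. s \<le> l \<and> s \<le> m} = {..min m l}" by auto
  have "real (x choose l) = (\<Sum>s\<le>l. real (m choose s) * real ((x - m) choose (l - s)))"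
    unfolding of_nat_mult[symmetric] of_nat_sum[symmetric] vandermonde using True by simp
  also have "\<dots> = (\<Sum>s\<le>min m l. real (m choose s) * real ((x - m) choose (l - s)))"
    by (rule sum.mono_neutral_right) (auto simp: binomial_eq_0)
  finally have "falling_fact x m * falling_fact x l = (\<Sum>s\<le>min m l. falling_fact x m * (fact l * (real (m choose s) * real ((x - m) choose (l - s)))))"
    by (simp add: falling_fact_def sum_distrib_left mult_ac)
  also have "\<dots> = (\<Sum>s\<le>min m l. fact m * fact l / (fact s * fact (m - s) * fact (l - s)) * falling_fact x (m + l - s))"
  proof (intro sum.cong refl)
    fix s assume s: "s \<in> {..min m l}"
    show "falling_fact x m * (fact l * (real (m choose s) * real ((x - m) choose (l - s)))) =
      fact m * fact l / (fact s * fact (m - s) * fact (l - s)) * falling_fact x (m + l - s)"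
    proof (cases "m + l - s \<le> x")
      case T: True
      then have "l - s \<le> x - m" "x - m - (l - s) = x - (m + l - s)" using s by auto
      then show ?thesis using s True T
        by (simp add: falling_fact_fact binomial_fact mult_ac)
    next
      case F: False
      then have "x - m < l - s" using s True by auto
      then show ?thesis using F by (simp add: falling_fact_def binomial_eq_0)
    qed
  qed
  finally show ?thesis .
next
  case False
  then show ?thesis by (auto simp: falling_fact_def binomial_eq_0 intro!: sum.neutral)
qed

text \<open>The factorial moments of the binomial distribution; the induction adds one element
  through \<open>(d + 1)_m = (d)_m + m (d)_(m-1)\<close>.\<close>

lemma bexp_falling_fact:
  assumes "finite S" "0 \<le> p" "p \<le> 1"
  shows "bexp p S (\<lambda>A. falling_fact (card A) m) = falling_fact (card S) m * p ^ m"
  using assms(1)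
proof (induction S arbitrary: m rule: finite_induct)
  case empty
  then show ?case by (cases m) (auto simp: falling_fact_def)
next
  case (insert x S)
  show ?case
  proof (cases m)
    case (Suc m')
    have "bexp p S (\<lambda>A. falling_fact (card (insert x A)) m) = bexp p S (\<lambda>A. falling_fact (card A) m + real m * falling_fact (card A) m')"
    proof (intro bexp_cong insert.hyps)
      fix A assume "A \<subseteq> S"
      then have "card (insert x A) = Suc (card A)" using insert.hyps by (auto simp: card_insert_if finite_subset)
      then show "falling_fact (card (insert x A)) m = falling_fact (card A) m + real m * falling_fact (card A) m'"
        using Suc by (simp add: falling_fact_Suc_Suc)
    qed
    also have "\<dots> = falling_fact (card S) m * p ^ m + real m * (falling_fact (card S) m' * p ^ m')"
      by (simp add: bexp_add bexp_cmult insert)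
    finally show ?thesis using insert.hyps assms
      by (simp add: bexp_insert insert.IH Suc falling_fact_Suc_Suc algebra_simps)
  qed simp
qed

section \<open>Degrees and their moments in the random graph\<close>

definition deg :: "'v set set \<Rightarrow> 'v \<Rightarrow> nat" where
  "deg A i = card {e \<in> A. i \<in> e}"

definition incident :: "nat \<Rightarrow> nat \<Rightarrow> nat set set" where
  "incident n i = {e \<in> possible_edges n. i \<in> e}"

lemma finite_possible_edges [simp]: "finite (possible_edges n)"
  by (rule finite_subset[of _ "Pow {1..n}"]) (auto simp: possible_edges_def)

lemma card_possible_edges_le: "card (possible_edges n) \<le> n\<^sup>2"
proof -
  have "card (possible_edges n) = n * (n - 1) div 2"
    unfolding possible_edges_def using n_subsets[of "{1..n}" 2] by (simp add: choose_two)
  also have "\<dots> \<le> n * (n - 1)" by (rule div_le_dividend)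
  also have "\<dots> \<le> n\<^sup>2" by (simp add: power2_eq_square)
  finally show ?thesis .
qed

lemma incident_eq:
  assumes "i \<in> {1..n}" shows "incident n i = (\<lambda>j. {i, j}) ` ({1..n} - {i})"
proof
  show "incident n i \<subseteq> (\<lambda>j. {i, j}) ` ({1..n} - {i})"
  proof
    fix e assume "e \<in> incident n i"
    then have e: "e \<subseteq> {1..n}" "card e = 2" "i \<in> e" by (auto simp: incident_def possible_edges_def)
    then obtain x y where "e = {x, y}" "x \<noteq> y" by (meson card_2_iff)
    then consider "e = {i, x}" "x \<in> {1..n} - {i}" | "e = {i, y}" "y \<in> {1..n} - {i}"
      using e by (auto simp: insert_commute)
    then show "e \<in> (\<lambda>j. {i, j}) ` ({1..n} - {i})" by cases auto
  qed
  show "(\<lambda>j. {i, j}) ` ({1..n} - {i}) \<subseteq> incident n i"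
    using assms by (auto simp: incident_def possible_edges_def card_insert_if)
qed

lemma incident_subset: "incident n i \<subseteq> possible_edges n"
  by (auto simp: incident_def)

lemma finite_incident [simp]: "finite (incident n i)"
  using incident_subset finite_possible_edges by (rule finite_subset)

lemma inj_on_pair: "inj_on (\<lambda>j. {i, j}) X"
  by (auto simp: inj_on_def doubleton_eq_iff)

lemma card_incident: "i \<in> {1..n} \<Longrightarrow> card (incident n i) = n - 1"
  by (subst incident_eq) (auto simp: card_image inj_on_pair)

lemma deg_eq_card_Int:
  assumes "A \<subseteq> possible_edges n" shows "deg A i = card (A \<inter> incident n i)"
  using assms by (auto simp: deg_def incident_def intro!: arg_cong[where f = card])

lemma sum_edge_ind:
  assumes "A \<subseteq> possible_edges n" "i \<in> {1..n}"
  shows "(\<Sum>j=1..n. edge_ind A i j) = real (deg A i)"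
proof -
  have "(\<Sum>j=1..n. edge_ind A i j) = real (card {j \<in> {1..n}. {i, j} \<in> A})"
    by (simp add: edge_ind_def of_bool_def sum.If_cases Int_def)
  also have "card {j \<in> {1..n}. {i, j} \<in> A} = card ((\<lambda>j. {i, j}) ` {j \<in> {1..n}. {i, j} \<in> A})"
    by (simp add: card_image inj_on_pair)
  also have "(\<lambda>j. {i, j}) ` {j \<in> {1..n}. {i, j} \<in> A} = A \<inter> incident n i"
  proof
    show "(\<lambda>j. {i, j}) ` {j \<in> {1..n}. {i, j} \<in> A} \<subseteq> A \<inter> incident n i"
      using assms(1) by (auto simp: incident_def)
    show "A \<inter> incident n i \<subseteq> (\<lambda>j. {i, j}) ` {j \<in> {1..n}. {i, j} \<in> A}"
      unfolding incident_eq[OF assms(2)] by auto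
  qed
  finally show ?thesis using deg_eq_card_Int[OF assms(1)] by simp
qed

definition degree_power_sum :: "nat \<Rightarrow> nat \<Rightarrow> nat set set \<Rightarrow> real" where
  "degree_power_sum k n A = (\<Sum>i=1..n. real (deg A i) ^ k)"

lemma zagreb_eq: "A \<subseteq> possible_edges n \<Longrightarrow> zagreb k n A = degree_power_sum k n A"
  unfolding zagreb_def degree_power_sum_def by (intro sum.cong refl) (simp only: sum_edge_ind)

lemma card_adjacent_edges:
  assumes "e \<in> possible_edges n"
  shows "real (card {j \<in> possible_edges n. j \<inter> e \<noteq> {}}) \<le> 2 * real n"
proof -
  have "{j \<in> possible_edges n. j \<inter> e \<noteq> {}} = (\<Union>i\<in>e. incident n i)"
    by (auto simp: incident_def)
  also have "card \<dots> \<le> (\<Sum>i\<in>e. card (incident n i))"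
    using assms by (intro card_UN_le) (auto simp: possible_edges_def intro: finite_subset)
  also have "\<dots> \<le> (\<Sum>i\<in>e. n)"
    using assms by (intro sum_mono) (auto simp: possible_edges_def card_incident subset_eq)
  also have "\<dots> = 2 * n" using assms by (simp add: possible_edges_def)
  finally show ?thesis by simp
qed

lemma bexp_deg:
  assumes "0 \<le> p" "p \<le> 1"
  shows "bexp p (possible_edges n) (\<lambda>A. f (deg A i)) = bexp p (incident n i) (\<lambda>A. f (card A))"
proof -
  have "bexp p (possible_edges n) (\<lambda>A. f (deg A i)) =
      bexp p (possible_edges n) (\<lambda>A. f (card (A \<inter> incident n i)))"
    by (intro bexp_cong) (auto simp: deg_eq_card_Int)
  also have "\<dots> = bexp p (incident n i) (\<lambda>A. f (card A))"
    by (intro bexp_marginal[OF assms] incident_subset) auto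
  finally show ?thesis .
qed

lemma bexp_deg_falling_fact:
  assumes "0 \<le> p" "p \<le> 1" "i \<in> {1..n}"
  shows "bexp p (possible_edges n) (\<lambda>A. falling_fact (deg A i) m) = falling_fact (n - 1) m * p ^ m"
  using bexp_deg[OF assms(1,2), of n "\<lambda>d. falling_fact d m"] bexp_falling_fact[of "incident n i" p m] assms
  by (simp add: card_incident)

text \<open>\<open>2 + d\<close> is at most 4 for \<open>d \<le> 2\<close> and at most
  \<open>2 * d\<close> otherwise; then \<open>d ^ r\<close> is expanded in falling factorials, whose
  means are at most \<open>(1 + n p) ^ r\<close>.\<close>

definition deg_moment_const :: "nat \<Rightarrow> real" where
  "deg_moment_const r = 4 ^ r + 2 ^ r * (\<Sum>m\<le>r. real (Stirling r m))"

lemma deg_moment_const_nonneg: "0 \<le> deg_moment_const r"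
  by (auto simp: deg_moment_const_def intro!: add_nonneg_nonneg mult_nonneg_nonneg sum_nonneg)

text \<open>The shift by 2 matches the largest base in second differences of \<open>x ^ k\<close>.
  The 1 in \<open>1 + n p\<close> keeps all lower powers below the \<open>r\<close>-th, also when
  \<open>n p\<close> is small.\<close>

lemma deg_moment_le:
  assumes p: "0 \<le> p" "p \<le> 1" and i: "i \<in> {1..n}"
  shows "bexp p (possible_edges n) (\<lambda>A. (2 + real (deg A i)) ^ r)
    \<le> deg_moment_const r * (1 + real n * p) ^ r"
proof -
  let ?l = "1 + real n * p"
  have l: "1 \<le> ?l" using p by simp
  have "bexp p (possible_edges n) (\<lambda>A. (2 + real (deg A i)) ^ r)
    \<le> bexp p (possible_edges n) (\<lambda>A. 4 ^ r + 2 ^ r * (\<Sum>m\<le>r. real (Stirling r m) * falling_fact (deg A i) m))"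
  proof (intro bexp_mono finite_possible_edges)
    fix A
    have "(2 + real d) ^ r \<le> 4 ^ r + 2 ^ r * real d ^ r" for d :: nat
    proof (cases "d \<le> 2")
      case True
      then have "(2 + real d) ^ r \<le> 4 ^ r" by (intro power_mono) auto
      also have "\<dots> \<le> 4 ^ r + 2 ^ r * real d ^ r" by simp
      finally show ?thesis .
    next
      case False
      then have "(2 + real d) ^ r \<le> (2 * real d) ^ r" by (intro power_mono) auto
      also have "\<dots> \<le> 4 ^ r + 2 ^ r * real d ^ r" by (simp add: power_mult_distrib)
      finally show ?thesis .
    qed
    from this[of "deg A i"] show "(2 + real (deg A i)) ^ r
        \<le> 4 ^ r + 2 ^ r * (\<Sum>m\<le>r. real (Stirling r m) * falling_fact (deg A i) m)"
      by (simp add: power_eq_sum_Stirling)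
  qed
  also have "\<dots> = 4 ^ r + 2 ^ r * (\<Sum>m\<le>r. real (Stirling r m) * (falling_fact (n - 1) m * p ^ m))"
    by (simp only: bexp_add bexp_cmult bexp_sum bexp_deg_falling_fact[OF p i] bexp_const finite_possible_edges)
  also have "\<dots> \<le> 4 ^ r * ?l ^ r + 2 ^ r * (\<Sum>m\<le>r. real (Stirling r m) * ?l ^ r)"
  proof (intro add_mono mult_left_mono sum_mono)
    show "4 ^ r \<le> 4 ^ r * ?l ^ r" using l by simp
    fix m assume m: "m \<in> {..r}"
    have "falling_fact (n - 1) m * p ^ m \<le> real (n - 1) ^ m * p ^ m"
      using p by (intro mult_right_mono falling_fact_le) auto
    also have "\<dots> \<le> ?l ^ m" unfolding power_mult_distrib[symmetric]
      using p mult_right_mono[of "real (n - 1)" "real n" p] by (intro power_mono) auto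
    also have "\<dots> \<le> ?l ^ r" using l m by (intro power_increasing) auto
    finally show "falling_fact (n - 1) m * p ^ m \<le> ?l ^ r" .
  qed auto
  also have "\<dots> = deg_moment_const r * ?l ^ r"
    by (simp add: deg_moment_const_def sum_distrib_right[symmetric] algebra_simps)
  finally show ?thesis .
qed

section \<open>First and second differences of the index and their fourth moments\<close>

lemma power_Suc_diff_le:
  fixes x :: real assumes "0 \<le> x"
  shows "0 \<le> (x + 1) ^ k - x ^ k" "(x + 1) ^ k - x ^ k \<le> real k * (x + 1) ^ (k - 1)"
proof -
  show "0 \<le> (x + 1) ^ k - x ^ k" using assms by (simp add: power_mono)
  show "(x + 1) ^ k - x ^ k \<le> real k * (x + 1) ^ (k - 1)"
  proof (induction k)
    case (Suc k)
    have "x * ((x + 1) ^ k - x ^ k) \<le> real k * (x + 1) ^ k"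
    proof (cases k)
      case (Suc k')
      have "x * ((x + 1) ^ k - x ^ k) \<le> (x + 1) * (real k * (x + 1) ^ (k - 1))"
        using Suc.IH assms by (intro mult_mono) (auto simp: power_mono)
      then show ?thesis using Suc by (simp add: algebra_simps)
    qed simp
    then show ?case by (simp add: algebra_simps)
  qed simp
qed

text \<open>Multiplication by \<open>x\<close> acts on second differences by the Leibniz rule
  \<open>eq\<close>, which drives the induction. The factor is that of the second derivative; the
  exponent \<open>k + 2\<close> avoids truncated subtraction.\<close>

lemma second_diff_power_le:
  fixes x :: real assumes "0 \<le> x"
  shows "0 \<le> (x + 2) ^ (k + 2) - 2 * (x + 1) ^ (k + 2) + x ^ (k + 2)"
    and "(x + 2) ^ (k + 2) - 2 * (x + 1) ^ (k + 2) + x ^ (k + 2) \<le> real ((k + 2) * (k + 1)) * (x + 2) ^ k"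
proof (induction k)
  case 0
  { case 1 then show ?case by (simp add: power2_eq_square algebra_simps) }
  { case 2 then show ?case by (simp add: power2_eq_square algebra_simps) }
next
  case (Suc k)
  define d where "d = (x + 2) ^ (k + 2) - 2 * (x + 1) ^ (k + 2) + x ^ (k + 2)"
  have eq: "(x + 2) ^ (Suc k + 2) - 2 * (x + 1) ^ (Suc k + 2) + x ^ (Suc k + 2)
      = x * d + 2 * ((x + 2) ^ (k + 2) - (x + 1) ^ (k + 2))"
    unfolding d_def by (simp add: algebra_simps)
  have h: "0 \<le> (x + 2) ^ (k + 2) - (x + 1) ^ (k + 2)"
    "(x + 2) ^ (k + 2) - (x + 1) ^ (k + 2) \<le> real (k + 2) * (x + 2) ^ (k + 1)"
    using power_Suc_diff_le[of "x + 1" "k + 2"] assms by (simp_all add: add.assoc)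
  { case 1 show ?case unfolding eq using Suc h(1) assms by (simp add: d_def del: power_Suc power_add) }
  { case 2
    have "x * d \<le> (x + 2) * (real ((k + 2) * (k + 1)) * (x + 2) ^ k)"
      using Suc assms unfolding d_def by (intro mult_mono) auto
    then show ?case unfolding eq using h(2) by (simp add: algebra_simps) }
qed

lemma sum_pow4_le:
  fixes y :: "'a \<Rightarrow> real"
  shows "(\<Sum>i\<in>I. y i) ^ 4 \<le> real (card I) ^ 3 * (\<Sum>i\<in>I. y i ^ 4)"
proof -
  have "(\<Sum>i\<in>I. y i) ^ 4 = ((\<Sum>i\<in>I. y i)\<^sup>2)\<^sup>2" by simp
  also have "\<dots> \<le> ((\<Sum>i\<in>I. (y i)\<^sup>2) * real (card I))\<^sup>2"
    by (intro power_mono sum_squared_le_sum_of_squares) auto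
  also have "\<dots> = (\<Sum>i\<in>I. (y i)\<^sup>2)\<^sup>2 * real (card I) ^ 2" by (simp add: power_mult_distrib)
  also have "\<dots> \<le> ((\<Sum>i\<in>I. ((y i)\<^sup>2)\<^sup>2) * real (card I)) * real (card I) ^ 2"
    by (intro mult_right_mono sum_squared_le_sum_of_squares) auto
  finally show ?thesis by (simp add: power2_eq_square power3_eq_cube power4_eq_xxxx mult_ac)
qed

lemma deg_insert:
  assumes "finite A"
  shows "deg (insert e A) i = deg (A - {e}) i + of_bool (i \<in> e)"
proof -
  have "{x \<in> insert e A. i \<in> x} = (if i \<in> e then insert e {x \<in> A - {e}. i \<in> x} else {x \<in> A - {e}. i \<in> x})"
    by auto
  then show ?thesis using assms by (auto simp: deg_def)
qed

lemma discrete_deriv_degree_power_sum: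
  assumes "finite A" "j \<in> possible_edges n"
  shows "discrete_deriv j (degree_power_sum k n) A =
    (\<Sum>i\<in>j. (real (deg (A - {j}) i) + 1) ^ k - real (deg (A - {j}) i) ^ k)"
proof -
  have "discrete_deriv j (degree_power_sum k n) A =
    (\<Sum>i=1..n. if i \<in> j then (real (deg (A - {j}) i) + 1) ^ k - real (deg (A - {j}) i) ^ k else 0)"
    unfolding discrete_deriv_def degree_power_sum_def sum_subtractf[symmetric]
    by (intro sum.cong refl) (auto simp: deg_insert assms add_ac)
  also have "\<dots> = (\<Sum>i\<in>j. (real (deg (A - {j}) i) + 1) ^ k - real (deg (A - {j}) i) ^ k)"
    using assms(2) by (intro sum.mono_neutral_cong_right) (auto simp: possible_edges_def)
  finally show ?thesis .
qed

text \<open>The first difference in \<open>j\<close> ignores \<open>j\<close>, hence 0 for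
  \<open>e = j\<close>. For other \<open>e\<close> the term of an endpoint \<open>i\<close> feels
  \<open>e\<close> only if \<open>i\<close> lies on it, and then becomes a second difference of
  \<open>x ^ k\<close>; edges without a common vertex give 0.\<close>

lemma discrete_deriv_discrete_deriv_degree_power_sum:
  assumes "finite A" "j \<in> possible_edges n"
  shows "discrete_deriv e (discrete_deriv j (degree_power_sum k n)) A =
    (\<Sum>i\<in>j. if i \<in> e \<and> e \<noteq> j then (real (deg (A - {e} - {j}) i) + 2) ^ k
      - 2 * (real (deg (A - {e} - {j}) i) + 1) ^ k + real (deg (A - {e} - {j}) i) ^ k else 0)"
proof (cases "e = j")
  case True
  then show ?thesis unfolding discrete_deriv_def[of e] using assms by (simp add: discrete_deriv_degree_power_sum)
next
  case False
  then have "insert e A - {j} = insert e (A - {j})" by auto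
  moreover have "A - {j} - {e} = A - {e} - {j}" by auto
  ultimately have "real (deg (insert e A - {j}) i) = real (deg (A - {e} - {j}) i) + of_bool (i \<in> e)" for i
    using deg_insert[of "A - {j}" e i] assms by simp
  then show ?thesis unfolding discrete_deriv_def[of e] using assms False
    by (simp add: discrete_deriv_degree_power_sum sum_subtractf[symmetric]) (intro sum.cong refl, auto simp: add_ac)
qed

lemma deg_mono: "finite A \<Longrightarrow> B \<subseteq> A \<Longrightarrow> deg B i \<le> deg A i"
  unfolding deg_def by (intro card_mono) auto

text \<open>One constant for both orders of differences: 16 is the cost of a fourth power of a sum
  over two endpoints, \<open>k ^ 8\<close> covers the fourth powers of \<open>k\<close> and of
  \<open>k * (k - 1)\<close>, and the summand 1 makes the constant at most its own fourth power,
  which avoids fourth roots.\<close>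

definition discrete_deriv_const :: "nat \<Rightarrow> real" where
  "discrete_deriv_const k = 1 + 16 * real k ^ 8 * (deg_moment_const ((k - 1) * 4) + deg_moment_const ((k - 2) * 4))"

lemma discrete_deriv_const_ge_1: "1 \<le> discrete_deriv_const k"
  using deg_moment_const_nonneg by (simp add: discrete_deriv_const_def)

lemma bexp_pow4_sum_edge_le:
  assumes p: "0 \<le> p" "p \<le> 1" and j: "j \<in> possible_edges n" and c: "0 \<le> c"
    and y: "\<And>A i. A \<subseteq> possible_edges n \<Longrightarrow> i \<in> j \<Longrightarrow> \<bar>y A i\<bar> \<le> c * (2 + real (deg A i)) ^ r"
  shows "bexp p (possible_edges n) (\<lambda>A. (\<Sum>i\<in>j. y A i) ^ 4)
    \<le> 16 * c ^ 4 * deg_moment_const (r * 4) * ((1 + real n * p) ^ r) ^ 4"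
proof -
  have j': "card j = 2" "j \<subseteq> {1..n}" using j by (auto simp: possible_edges_def)
  have "bexp p (possible_edges n) (\<lambda>A. (\<Sum>i\<in>j. y A i) ^ 4)
    \<le> bexp p (possible_edges n) (\<lambda>A. (8 * c ^ 4) * (\<Sum>i\<in>j. (2 + real (deg A i)) ^ (r * 4)))"
  proof (intro bexp_mono finite_possible_edges)
    fix A assume A: "A \<subseteq> possible_edges n"
    have "(\<Sum>i\<in>j. y A i) ^ 4 \<le> 8 * (\<Sum>i\<in>j. y A i ^ 4)"
      using sum_pow4_le[of "y A" j] j' by simp
    also have "\<dots> \<le> 8 * (\<Sum>i\<in>j. (c * (2 + real (deg A i)) ^ r) ^ 4)"
    proof (intro mult_left_mono sum_mono)
      fix i assume "i \<in> j"
      then have "\<bar>y A i\<bar> ^ 4 \<le> (c * (2 + real (deg A i)) ^ r) ^ 4"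
        by (intro power_mono y A) auto
      then show "y A i ^ 4 \<le> (c * (2 + real (deg A i)) ^ r) ^ 4" by simp
    qed auto
    also have "\<dots> = (8 * c ^ 4) * (\<Sum>i\<in>j. (2 + real (deg A i)) ^ (r * 4))"
      by (simp add: power_mult_distrib power_mult sum_distrib_left[symmetric])
    finally show "(\<Sum>i\<in>j. y A i) ^ 4 \<le> (8 * c ^ 4) * (\<Sum>i\<in>j. (2 + real (deg A i)) ^ (r * 4))" .
  qed
  also have "\<dots> = (8 * c ^ 4) * (\<Sum>i\<in>j. bexp p (possible_edges n) (\<lambda>A. (2 + real (deg A i)) ^ (r * 4)))"
    by (simp add: bexp_cmult bexp_sum)
  also have "\<dots> \<le> (8 * c ^ 4) * (\<Sum>i\<in>j. deg_moment_const (r * 4) * (1 + real n * p) ^ (r * 4))"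
    using c j' by (intro mult_left_mono sum_mono deg_moment_le p) auto
  also have "\<dots> = 16 * c ^ 4 * deg_moment_const (r * 4) * ((1 + real n * p) ^ r) ^ 4"
    using j' by (simp add: power_mult)
  finally show ?thesis .
qed

lemma bexp_discrete_deriv_le:
  assumes p: "0 \<le> p" "p \<le> 1" and j: "j \<in> possible_edges n" and k: "1 \<le> k"
  shows "bexp p (possible_edges n) (\<lambda>A. discrete_deriv j (degree_power_sum k n) A ^ 4)
    \<le> (discrete_deriv_const k * (1 + real n * p) ^ (k - 1)) ^ 4"
proof -
  let ?l = "1 + real n * p"
  have "bexp p (possible_edges n) (\<lambda>A. discrete_deriv j (degree_power_sum k n) A ^ 4)
    = bexp p (possible_edges n) (\<lambda>A. (\<Sum>i\<in>j. (real (deg (A - {j}) i) + 1) ^ k - real (deg (A - {j}) i) ^ k) ^ 4)"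
    by (intro bexp_cong) (auto simp: discrete_deriv_degree_power_sum j finite_subset)
  also have "\<dots> \<le> 16 * real k ^ 4 * deg_moment_const ((k - 1) * 4) * (?l ^ (k - 1)) ^ 4"
  proof (intro bexp_pow4_sum_edge_le p j)
    fix A i assume A: "A \<subseteq> possible_edges n" and "i \<in> j"
    have "real (deg (A - {j}) i) \<le> real (deg A i)"
      using deg_mono[OF finite_subset[OF A], of "A - {j}" i] by auto
    then have "real k * (real (deg (A - {j}) i) + 1) ^ (k - 1) \<le> real k * (2 + real (deg A i)) ^ (k - 1)"
      by (intro mult_left_mono power_mono) auto
    then show "\<bar>(real (deg (A - {j}) i) + 1) ^ k - real (deg (A - {j}) i) ^ k\<bar>
        \<le> real k * (2 + real (deg A i)) ^ (k - 1)"
      using power_Suc_diff_le[of "real (deg (A - {j}) i)" k] by linarith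
  qed auto
  also have "\<dots> \<le> discrete_deriv_const k ^ 4 * (?l ^ (k - 1)) ^ 4"
  proof (intro mult_right_mono)
    have "real k ^ 4 \<le> real k ^ 8" using k by (intro power_increasing) auto
    then have "16 * real k ^ 4 * deg_moment_const ((k - 1) * 4)
       \<le> 16 * real k ^ 8 * (deg_moment_const ((k - 1) * 4) + deg_moment_const ((k - 2) * 4))"
      using deg_moment_const_nonneg[of "(k - 1) * 4"] deg_moment_const_nonneg[of "(k - 2) * 4"]
      by (intro mult_mono) auto
    also have "\<dots> \<le> discrete_deriv_const k" by (simp add: discrete_deriv_const_def)
    also have "\<dots> \<le> discrete_deriv_const k ^ 4" using discrete_deriv_const_ge_1[of k] by (intro self_le_power) auto
    finally show "16 * real k ^ 4 * deg_moment_const ((k - 1) * 4) \<le> discrete_deriv_const k ^ 4" .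
  qed auto
  finally show ?thesis by (simp add: power_mult_distrib)
qed

text \<open>The gain over a first difference is one factor \<open>1 + n p\<close>. It is written as
  a quotient because \<open>k - 2\<close> would truncate for \<open>k = 1\<close>, where second
  differences vanish.\<close>

lemma bexp_discrete_deriv_discrete_deriv_le:
  assumes p: "0 \<le> p" "p \<le> 1" and j: "j \<in> possible_edges n" and k: "1 \<le> k"
  shows "bexp p (possible_edges n) (\<lambda>A. discrete_deriv e (discrete_deriv j (degree_power_sum k n)) A ^ 4)
    \<le> (discrete_deriv_const k * (1 + real n * p) ^ (k - 1) / (1 + real n * p)) ^ 4"
proof -
  let ?l = "1 + real n * p"
  have l: "1 \<le> ?l" using p by simp
  define y where "y = (\<lambda>A i. if i \<in> e \<and> e \<noteq> j then (real (deg (A - {e} - {j}) i) + 2) ^ k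
      - 2 * (real (deg (A - {e} - {j}) i) + 1) ^ k + real (deg (A - {e} - {j}) i) ^ k else 0)"
  have eq: "bexp p (possible_edges n) (\<lambda>A. discrete_deriv e (discrete_deriv j (degree_power_sum k n)) A ^ 4)
    = bexp p (possible_edges n) (\<lambda>A. (\<Sum>i\<in>j. y A i) ^ 4)"
    unfolding y_def by (intro bexp_cong) (auto simp: discrete_deriv_discrete_deriv_degree_power_sum j finite_subset)
  show ?thesis
  proof (cases "k = 1")
    case True
    then have "y A i = 0" for A i by (simp add: y_def)
    then show ?thesis using l by (simp add: eq)
  next
    case False
    then obtain m where m: "k = m + 2" using k by (metis Suc_1 add.commute add_2_eq_Suc le_neq_implies_less less_iff_Suc_add not_less_eq_eq nat_le_iff_add)
    have "bexp p (possible_edges n) (\<lambda>A. (\<Sum>i\<in>j. y A i) ^ 4)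
      \<le> 16 * real (k * (k - 1)) ^ 4 * deg_moment_const (m * 4) * (?l ^ m) ^ 4"
    proof (intro bexp_pow4_sum_edge_le p j)
      fix A i assume A: "A \<subseteq> possible_edges n" and "i \<in> j"
      have "real (deg (A - {e} - {j}) i) \<le> real (deg A i)"
        using deg_mono[OF finite_subset[OF A], of "A - {e} - {j}" i] by auto
      then have "real (k * (k - 1)) * (real (deg (A - {e} - {j}) i) + 2) ^ m \<le> real (k * (k - 1)) * (2 + real (deg A i)) ^ m"
        by (intro mult_left_mono power_mono) auto
      then show "\<bar>y A i\<bar> \<le> real (k * (k - 1)) * (2 + real (deg A i)) ^ m"
        using second_diff_power_le[of "real (deg (A - {e} - {j}) i)" m]
        unfolding y_def m by auto
    qed auto
    also have "\<dots> \<le> discrete_deriv_const k ^ 4 * (?l ^ m) ^ 4"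
    proof (intro mult_right_mono)
      have "real (k * (k - 1)) ^ 4 \<le> real (k * k) ^ 4"
        by (intro power_mono of_nat_mono mult_le_mono) auto
      then have "real (k * (k - 1)) ^ 4 \<le> real k ^ 8" by (simp add: power_mult_distrib flip: power_add)
      then have "16 * real (k * (k - 1)) ^ 4 * deg_moment_const (m * 4)
         \<le> 16 * real k ^ 8 * (deg_moment_const ((k - 1) * 4) + deg_moment_const (m * 4))"
        using deg_moment_const_nonneg[of "(k - 1) * 4"] deg_moment_const_nonneg[of "m * 4"]
        by (intro mult_mono) auto
      also have "\<dots> \<le> discrete_deriv_const k" by (simp add: discrete_deriv_const_def m)
      also have "\<dots> \<le> discrete_deriv_const k ^ 4" using discrete_deriv_const_ge_1[of k] by (intro self_le_power) auto
      finally show "16 * real (k * (k - 1)) ^ 4 * deg_moment_const (m * 4) \<le> discrete_deriv_const k ^ 4" .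
    qed auto
    also have "?l ^ m = ?l ^ (k - 1) / ?l" using l m by simp
    finally show ?thesis by (simp add: eq power_mult_distrib power_divide)
  qed
qed

section \<open>The variance of the sum of degree powers\<close>

lemma bcov_cmult_left: "bcov p E (\<lambda>A. c * F A) G = c * bcov p E F G"
  using bexp_cmult[of p E c "\<lambda>A. F A * G A"] by (simp add: bcov_def bexp_cmult mult.assoc algebra_simps)

lemma bcov_commute: "bcov p E F G = bcov p E G F"
  by (simp add: bcov_def mult.commute)

lemma bcov_sum_left:
  "finite E \<Longrightarrow> bcov p E (\<lambda>A. \<Sum>i\<in>I. F i A) G = (\<Sum>i\<in>I. bcov p E (F i) G)"
  by (simp add: bcov_def bexp_sum sum_distrib_right sum_subtractf)

lemma bcov_sum_sum:
  assumes "finite E"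
  shows "bcov p E (\<lambda>A. \<Sum>i\<in>I. c i * F i A) (\<lambda>A. \<Sum>j\<in>J. d j * G j A) =
    (\<Sum>i\<in>I. \<Sum>j\<in>J. c i * d j * bcov p E (F i) (G j))"
proof -
  have "bcov p E (\<lambda>A. \<Sum>i\<in>I. c i * F i A) H = (\<Sum>i\<in>I. c i * bcov p E (F i) H)" for c F I H
    by (simp add: bcov_sum_left assms bcov_cmult_left)
  note * = this
  have "bcov p E (\<lambda>A. \<Sum>i\<in>I. c i * F i A) (\<lambda>A. \<Sum>j\<in>J. d j * G j A) =
    (\<Sum>i\<in>I. c i * bcov p E (F i) (\<lambda>A. \<Sum>j\<in>J. d j * G j A))"
    by (rule *)
  also have "\<dots> = (\<Sum>i\<in>I. c i * (\<Sum>j\<in>J. d j * bcov p E (F i) (G j)))"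
    by (subst bcov_commute) (subst *, simp only: bcov_commute[of p E "G _"])
  finally show ?thesis by (simp add: sum_distrib_left mult.assoc)
qed

text \<open>The coefficient of \<open>(x)_{m+l-s}\<close> in the product of the falling factorials \<open>(x)_m (x)_l\<close>.\<close>
definition stirling_coeff :: "nat \<Rightarrow> nat \<Rightarrow> nat \<Rightarrow> real" where
  "stirling_coeff m l s = fact m * fact l / (fact s * fact (m - s) * fact (l - s))"

text \<open>Expanding both the product and the product of the means by
  \<open>falling_fact_prod\<close> pairs the terms and leaves \<open>1 - p ^ s\<close>; the term
  \<open>s = 0\<close> drops out, so the sum starts at 1.\<close>

lemma bcov_deg_same:
  assumes p: "0 \<le> p" "p \<le> 1" and i: "i \<in> {1..n}"
  shows "bcov p (possible_edges n) (\<lambda>A. falling_fact (deg A i) m) (\<lambda>A. falling_fact (deg A i) l) =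
    (\<Sum>s=1..min m l. stirling_coeff m l s * (falling_fact (n - 1) (m + l - s) * p ^ (m + l - s) * (1 - p ^ s)))"
proof -
  let ?c = "stirling_coeff m l"
  have prod: "falling_fact x m * falling_fact x l = (\<Sum>s\<le>min m l. ?c s * falling_fact x (m + l - s))" for x
    unfolding stirling_coeff_def by (rule falling_fact_prod)
  have "bcov p (possible_edges n) (\<lambda>A. falling_fact (deg A i) m) (\<lambda>A. falling_fact (deg A i) l) =
    (\<Sum>s\<le>min m l. ?c s * (falling_fact (n - 1) (m + l - s) * p ^ (m + l - s))) - (falling_fact (n - 1) m * falling_fact (n - 1) l) * p ^ (m + l)"
  proof -
    have "bexp p (possible_edges n) (\<lambda>A. falling_fact (deg A i) m * falling_fact (deg A i) l) =
      (\<Sum>s\<le>min m l. ?c s * (falling_fact (n - 1) (m + l - s) * p ^ (m + l - s)))"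
      unfolding prod by (simp only: bexp_sum finite_possible_edges bexp_cmult bexp_deg_falling_fact[OF p i])
    then show ?thesis unfolding bcov_def bexp_deg_falling_fact[OF p i] by (simp only: power_add mult_ac)
  qed
  also have "\<dots> = (\<Sum>s\<le>min m l. ?c s * (falling_fact (n - 1) (m + l - s) * p ^ (m + l - s) * (1 - p ^ s)))"
    unfolding prod sum_distrib_right sum_subtractf[symmetric]
  proof (intro sum.cong refl)
    fix s assume "s \<in> {..min m l}"
    then have "p ^ (m + l) = p ^ (m + l - s) * p ^ s" by (simp flip: power_add)
    then show "?c s * (falling_fact (n - 1) (m + l - s) * p ^ (m + l - s)) - ?c s * falling_fact (n - 1) (m + l - s) * p ^ (m + l)
      = ?c s * (falling_fact (n - 1) (m + l - s) * p ^ (m + l - s) * (1 - p ^ s))"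
      by (simp add: algebra_simps)
  qed
  also have "\<dots> = (\<Sum>s=1..min m l. ?c s * (falling_fact (n - 1) (m + l - s) * p ^ (m + l - s) * (1 - p ^ s)))"
    by (rule sum.mono_neutral_right) (auto simp: not_le Suc_le_eq)
  finally show ?thesis .
qed

text \<open>The edge \<open>{i, j}\<close> is the only one that both degrees see. Given its state
  they are independent, so the covariance is \<open>p * (1 - p)\<close> times the product of the
  jumps of the two conditional means; each jump is a factorial moment, one order lower, over the
  other \<open>n - 2\<close> edges at the vertex.\<close>

lemma bcov_deg_different:
  assumes p: "0 \<le> p" "p \<le> 1" and ij: "i \<in> {1..n}" "j \<in> {1..n}" "i \<noteq> j"
  shows "bcov p (possible_edges n) (\<lambda>A. falling_fact (deg A i) (Suc m)) (\<lambda>A. falling_fact (deg A j) (Suc l)) =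
    real (Suc m) * real (Suc l) * (p * (1 - p)) * (falling_fact (n - 2) m * falling_fact (n - 2) l * p ^ (m + l))"
proof -
  define e where "e = {i, j}"
  define E where "E = possible_edges n - {e}"
  define I where "I = (\<lambda>v. incident n v - {e})"
  have E: "possible_edges n = insert e E" "finite E" "e \<notin> E"
    using ij by (auto simp: E_def e_def possible_edges_def card_insert_if)
  have I: "I v \<subseteq> E" "finite (I v)" for v
    using incident_subset by (auto simp: I_def E_def)
  have cardI: "card (I v) = n - 2" if "v \<in> e" for v
  proof -
    have "e \<in> incident n v" using that ij by (auto simp: E(1) incident_def)
    then show ?thesis using that ij card_incident[of v n] by (auto simp: I_def e_def)
  qed
  have disj: "I i \<inter> I j = {}"
  proof -
    have "f = e" if "f \<in> incident n i" "f \<in> incident n j" for f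
    proof -
      have "card f = 2" "e \<subseteq> f" "card e = 2" "finite f"
        using that ij by (auto simp: incident_def possible_edges_def e_def card_insert_if intro: finite_subset)
      then show ?thesis by (metis card_subset_eq)
    qed
    then show ?thesis by (auto simp: I_def)
  qed
  have deg0: "deg A v = card (A \<inter> I v)" if "A \<subseteq> E" for A v
  proof -
    have "A \<inter> incident n v = A \<inter> I v" using that by (auto simp: I_def E_def)
    moreover have "A \<subseteq> possible_edges n" using that by (auto simp: E_def)
    ultimately show ?thesis by (simp add: deg_eq_card_Int)
  qed
  have deg1: "deg (insert e A) v = Suc (card (A \<inter> I v))" if "A \<subseteq> E" "v \<in> e" for A v
  proof -
    have "A - {e} = A" "finite A" using that E by (auto intro: finite_subset)
    then show ?thesis using deg_insert[of A e v] deg0[OF that(1), of v] that(2) by simp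
  qed
  let ?m0 = "\<lambda>v r. bexp p (I v) (\<lambda>A. falling_fact (card A) r)"
  let ?m1 = "\<lambda>v r. bexp p (I v) (\<lambda>A. falling_fact (Suc (card A)) r)"
  have mean: "bexp p (possible_edges n) (\<lambda>A. falling_fact (deg A v) r) = p * ?m1 v r + (1 - p) * ?m0 v r"
    if v: "v \<in> e" for v r
  proof -
    have "bexp p (possible_edges n) (\<lambda>A. falling_fact (deg A v) r) =
      p * bexp p E (\<lambda>A. falling_fact (Suc (card (A \<inter> I v))) r) + (1 - p) * bexp p E (\<lambda>A. falling_fact (card (A \<inter> I v)) r)"
      unfolding E(1) bexp_insert[OF E(2,3) p]
      by (intro arg_cong2[where f="(+)"] arg_cong2[where f="(*)"] refl bexp_cong E) (simp_all add: deg0 deg1 v)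
    also have "bexp p E (\<lambda>A. falling_fact (Suc (card (A \<inter> I v))) r) = ?m1 v r"
      by (rule bexp_marginal[OF p E(2) I(1)])
    also have "bexp p E (\<lambda>A. falling_fact (card (A \<inter> I v)) r) = ?m0 v r"
      by (rule bexp_marginal[OF p E(2) I(1)])
    finally show ?thesis .
  qed
  have ie: "i \<in> e" "j \<in> e" by (auto simp: e_def)
  have prod: "bexp p (possible_edges n) (\<lambda>A. falling_fact (deg A i) r * falling_fact (deg A j) t) =
      p * (?m1 i r * ?m1 j t) + (1 - p) * (?m0 i r * ?m0 j t)" for r t
  proof -
    have "bexp p (possible_edges n) (\<lambda>A. falling_fact (deg A i) r * falling_fact (deg A j) t) =
      p * bexp p E (\<lambda>A. falling_fact (Suc (card (A \<inter> I i))) r * falling_fact (Suc (card (A \<inter> I j))) t)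
      + (1 - p) * bexp p E (\<lambda>A. falling_fact (card (A \<inter> I i)) r * falling_fact (card (A \<inter> I j)) t)"
      unfolding E(1) bexp_insert[OF E(2,3) p]
      by (intro arg_cong2[where f="(+)"] arg_cong2[where f="(*)"] refl bexp_cong E) (simp_all add: deg0 deg1 ie)
    also have "bexp p E (\<lambda>A. falling_fact (Suc (card (A \<inter> I i))) r * falling_fact (Suc (card (A \<inter> I j))) t) = ?m1 i r * ?m1 j t"
      by (rule bexp_indep[OF p E(2) I(1) I(1) disj])
    also have "bexp p E (\<lambda>A. falling_fact (card (A \<inter> I i)) r * falling_fact (card (A \<inter> I j)) t) = ?m0 i r * ?m0 j t"
      by (rule bexp_indep[OF p E(2) I(1) I(1) disj])
    finally show ?thesis .
  qed
  have diff: "?m1 v (Suc r) - ?m0 v (Suc r) = real (Suc r) * (falling_fact (n - 2) r * p ^ r)" if "v \<in> e" for v r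
  proof -
    have "?m1 v (Suc r) - ?m0 v (Suc r) = bexp p (I v) (\<lambda>A. real (Suc r) * falling_fact (card A) r)"
      by (simp add: bexp_diff[symmetric] I falling_fact_Suc_Suc)
    then show ?thesis using cardI[OF that] by (simp only: bexp_cmult bexp_falling_fact[OF I(2) p])
  qed
  have "bcov p (possible_edges n) (\<lambda>A. falling_fact (deg A i) (Suc m)) (\<lambda>A. falling_fact (deg A j) (Suc l)) =
    p * (1 - p) * ((?m1 i (Suc m) - ?m0 i (Suc m)) * (?m1 j (Suc l) - ?m0 j (Suc l)))"
    unfolding bcov_def prod mean[OF ie(1)] mean[OF ie(2)] by algebra
  also have "\<dots> = real (Suc m) * real (Suc l) * (p * (1 - p)) * (falling_fact (n - 2) m * falling_fact (n - 2) l * p ^ (m + l))"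
    unfolding diff[OF ie(1)] diff[OF ie(2)] by (simp only: power_add mult_ac)
  finally show ?thesis .
qed

text \<open>Each degree is binomial over \<open>n - 1\<close> edges, and \<open>n (n - 1)_m\<close>
  is \<open>fact_quot n m\<close>, also for \<open>m \<ge> n\<close>, where both are 0.\<close>

lemma bexp_degree_power_sum:
  assumes p: "0 \<le> p" "p \<le> 1" and k: "1 \<le> k"
  shows "bexp p (possible_edges n) (degree_power_sum k n) = zagreb_center k n p"
proof -
  have fq: "real n * falling_fact (n - 1) m = fact_quot n m" for m
  proof (cases "m < n")
    case True
    then have "real n * fact (n - 1) = (fact n :: real)" by (subst fact_reduce) auto
    moreover have "n - Suc m = n - 1 - m" by simp
    ultimately show ?thesis using True by (simp add: fact_quot_def falling_fact_fact)
  qed (auto simp: fact_quot_def falling_fact_def binomial_eq_0)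
  have "bexp p (possible_edges n) (degree_power_sum k n) =
      (\<Sum>i=1..n. \<Sum>m=1..k. real (Stirling k m) * (falling_fact (n - 1) m * p ^ m))"
    unfolding degree_power_sum_def power_eq_sum_Stirling'[OF k]
    by (simp only: bexp_sum bexp_cmult finite_possible_edges)
       (intro sum.cong refl, simp only: bexp_deg_falling_fact[OF p])
  also have "\<dots> = (\<Sum>m=1..k. real (Stirling k m) * (real n * falling_fact (n - 1) m) * p ^ m)"
    by (simp add: sum_distrib_left mult_ac)
  finally show ?thesis by (simp only: fq zagreb_center_def)
qed

text \<open>
  The sum under the root in the normalization of the theorem with each power \<open>n ^ r\<close> replaced
  by a product of \<open>r\<close> factors between \<open>n - 2 k - 2\<close> and \<open>n\<close>, which makes it the exact variance.
\<close>
definition zagreb_var :: "nat \<Rightarrow> nat \<Rightarrow> real \<Rightarrow> real" where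
  "zagreb_var k n p = real n * (\<Sum>m=1..k. \<Sum>l=1..k. real (Stirling k m) * real (Stirling k l) *
     (real m * real l * (real (n - 1) * falling_fact (n - 2) (m - 1) * falling_fact (n - 2) (l - 1) * p ^ (m + l - 1)) * (1 - p) +
      (\<Sum>s=1..min m l. stirling_coeff m l s * (falling_fact (n - 1) (m + l - s) * p ^ (m + l - s) * (1 - p ^ s)))))"

lemma bcov_degree_power_sum:
  assumes p: "0 \<le> p" "p \<le> 1" and k: "1 \<le> k"
  shows "bcov p (possible_edges n) (degree_power_sum k n) (degree_power_sum k n) = zagreb_var k n p"
proof -
  let ?S = "\<lambda>m. real (Stirling k m)"
  let ?c = "\<lambda>i j m l. bcov p (possible_edges n) (\<lambda>A. falling_fact (deg A i) m) (\<lambda>A. falling_fact (deg A j) l)"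
  define X where "X = (\<lambda>m l. \<Sum>s=1..min m l. stirling_coeff m l s * (falling_fact (n - 1) (m + l - s) * p ^ (m + l - s) * (1 - p ^ s)))"
  define Y where "Y = (\<lambda>m l. real m * real l * (falling_fact (n - 2) (m - 1) * falling_fact (n - 2) (l - 1) * p ^ (m + l - 1)) * (1 - p))"
  have c: "?c i j m l = (if j = i then X m l else Y m l)"
    if ij: "i \<in> {1..n}" "j \<in> {1..n}" and ml: "m \<in> {1..k}" "l \<in> {1..k}" for i j m l
  proof (cases "i = j")
    case True
    then show ?thesis using bcov_deg_same[OF p ij(1)] by (simp add: X_def)
  next
    case False
    obtain m' where m: "m = Suc m'" using ml(1) by (cases m) auto
    obtain l' where l: "l = Suc l'" using ml(2) by (cases l) auto
    then show ?thesis using False bcov_deg_different[OF p ij False, of m' l']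
      by (simp add: Y_def m l power_add algebra_simps)
  qed
  have "bcov p (possible_edges n) (degree_power_sum k n) (degree_power_sum k n) =
    (\<Sum>i=1..n. \<Sum>j=1..n. bcov p (possible_edges n) (\<lambda>A. \<Sum>m=1..k. ?S m * falling_fact (deg A i) m) (\<lambda>A. \<Sum>m=1..k. ?S m * falling_fact (deg A j) m))"
    unfolding degree_power_sum_def power_eq_sum_Stirling'[OF k]
    using bcov_sum_sum[of "possible_edges n" p "\<lambda>_. 1" _ "{1..n}" "\<lambda>_. 1" _ "{1..n}"] by simp
  also have "\<dots> = (\<Sum>i=1..n. \<Sum>j=1..n. \<Sum>m=1..k. \<Sum>l=1..k. ?S m * ?S l * ?c i j m l)"
    by (simp only: bcov_sum_sum finite_possible_edges)
  also have "\<dots> = (\<Sum>i=1..n. \<Sum>j=1..n. \<Sum>m=1..k. \<Sum>l=1..k. ?S m * ?S l * (if j = i then X m l else Y m l))"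
    by (intro sum.cong refl arg_cong2[where f="(*)"] c)
  also have "\<dots> = (\<Sum>m=1..k. \<Sum>l=1..k. \<Sum>i=1..n. \<Sum>j=1..n. ?S m * ?S l * (if j = i then X m l else Y m l))"
    by (simp only: sum.swap[where B = "{1..k}" and A = "{1..n}"])
  \<comment> \<open>There are \<open>n\<close> diagonal pairs and \<open>n * (n - 1)\<close> pairs
    of distinct vertices.\<close>
  also have "\<dots> = (\<Sum>m=1..k. \<Sum>l=1..k. ?S m * ?S l * (real n * (X m l + real (n - 1) * Y m l)))"
  proof (intro sum.cong refl)
    fix m l
    have "(\<Sum>j=1..n. if j = i then X m l else Y m l) = X m l + real (n - 1) * Y m l" if "i \<in> {1..n}" for i
      using that by (subst sum.remove[of _ i]) auto
    then show "(\<Sum>i=1..n. \<Sum>j=1..n. ?S m * ?S l * (if j = i then X m l else Y m l))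
        = ?S m * ?S l * (real n * (X m l + real (n - 1) * Y m l))"
      by (simp add: sum_distrib_left[symmetric] del: of_nat_diff One_nat_def)
  qed
  also have "\<dots> = zagreb_var k n p"
  proof -
    have X: "(\<Sum>s=1..min m l. stirling_coeff m l s * (falling_fact (n - 1) (m + l - s) * p ^ (m + l - s) * (1 - p ^ s))) = X m l" for m l
      by (simp add: X_def)
    show ?thesis
      unfolding zagreb_var_def X Y_def sum_distrib_left[of "real n"]
      by (intro sum.cong refl) (simp add: algebra_simps)
  qed
  finally show ?thesis .
qed

section \<open>The exact variance against the square of the scale\<close>

definition zagreb_scale_sq :: "nat \<Rightarrow> nat \<Rightarrow> real \<Rightarrow> real" where
  "zagreb_scale_sq k n p = real n * (\<Sum>m=1..k. \<Sum>l=1..k. real (Stirling k m) * real (Stirling k l) *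
        (real m * real l * (real n * p) ^ (m + l - 1) * (1 - p) +
         (\<Sum>s=1..min m l. stirling_coeff m l s * ((real n * p) ^ (m + l - s) * (1 - p ^ s)))))"

lemma zagreb_scale_eq: "zagreb_scale k n p = sqrt (zagreb_scale_sq k n p)"
  by (simp only: zagreb_scale_def zagreb_scale_sq_def stirling_coeff_def times_divide_eq_left mult.assoc)

lemma stirling_coeff_nonneg [simp]: "0 \<le> stirling_coeff m l s"
  by (simp add: stirling_coeff_def)

lemma zagreb_var_le:
  assumes p: "0 \<le> p" "p \<le> 1"
  shows "zagreb_var k n p \<le> zagreb_scale_sq k n p"
  unfolding zagreb_var_def zagreb_scale_sq_def
proof (intro mult_left_mono sum_mono add_mono mult_right_mono)
  fix m l assume ml: "m \<in> {1..k}" "l \<in> {1..k}"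
  have "real (n - 1) * falling_fact (n - 2) (m - 1) * falling_fact (n - 2) (l - 1) \<le> real n * real n ^ (m - 1) * real n ^ (l - 1)"
    by (intro mult_mono order_trans[OF falling_fact_le] power_mono) auto
  also have "\<dots> = real n ^ (m + l - 1)" using ml by (cases m; cases l) (auto simp: power_add)
  finally show "real (n - 1) * falling_fact (n - 2) (m - 1) * falling_fact (n - 2) (l - 1) * p ^ (m + l - 1) \<le> (real n * p) ^ (m + l - 1)"
    using p unfolding power_mult_distrib by (intro mult_right_mono) auto
next
  fix m l s
  have "falling_fact (n - 1) (m + l - s) \<le> real n ^ (m + l - s)"
    by (intro order_trans[OF falling_fact_le] power_mono) auto
  then show "falling_fact (n - 1) (m + l - s) * p ^ (m + l - s) \<le> (real n * p) ^ (m + l - s)"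
    using p unfolding power_mult_distrib by (intro mult_right_mono) auto
qed (use p in \<open>auto intro: power_le_one\<close>)

text \<open>All summands are nonnegative, so factors can be compared: those replacing an
  \<open>n\<close> are at least \<open>n - 2 k - 2\<close>, a fraction \<open>t\<close> of
  \<open>n\<close>, and there are at most \<open>2 k\<close> of them in a product. The resulting
  ratio is free of \<open>p\<close>.\<close>

lemma zagreb_var_ge:
  assumes p: "0 \<le> p" "p \<le> 1" and n: "2 * k + 2 \<le> n"
  shows "((real n - real (2 * k + 2)) / real n) ^ (2 * k) * zagreb_scale_sq k n p \<le> zagreb_var k n p"
proof -
  define t where "t = (real n - real (2 * k + 2)) / real n"
  have t: "0 \<le> t" "t \<le> 1" and tn: "real n - real (2 * k + 2) = t * real n" using n by (auto simp: t_def)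
  have pw: "t ^ (2 * k) * real n ^ r \<le> (t * real n) ^ r" if "r \<le> 2 * k" for r
    unfolding power_mult_distrib using t that by (intro mult_right_mono power_decreasing) auto
  have "t ^ (2 * k) * zagreb_scale_sq k n p = real n * (\<Sum>m=1..k. \<Sum>l=1..k. real (Stirling k m) * real (Stirling k l) *
        (real m * real l * (t ^ (2 * k) * (real n * p) ^ (m + l - 1)) * (1 - p) +
         (\<Sum>s=1..min m l. stirling_coeff m l s * (t ^ (2 * k) * (real n * p) ^ (m + l - s) * (1 - p ^ s)))))"
    unfolding zagreb_scale_sq_def by (simp add: sum_distrib_left distrib_left mult_ac)
  also have "\<dots> \<le> zagreb_var k n p"
    unfolding zagreb_var_def
  proof (intro mult_left_mono sum_mono add_mono mult_right_mono)
    fix m l assume ml: "m \<in> {1..k}" "l \<in> {1..k}"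
    have ge: "(t * real n) ^ (r - 1) \<le> falling_fact (n - 2) (r - 1)" if "r \<in> {1..k}" for r
    proof -
      have "real (n - 2) - real (2 * k) = t * real n" using n tn by (simp add: of_nat_diff)
      moreover have "r - 1 \<le> 2 * k" "2 * k \<le> n - 2" using n that by auto
      ultimately show ?thesis using falling_fact_ge[of "r - 1" "2 * k" "n - 2"] by simp
    qed
    have "t ^ (2 * k) * real n ^ (m + l - 1) \<le> (t * real n) ^ (m + l - 1)" using ml by (intro pw) auto
    also have "\<dots> = (t * real n) * (t * real n) ^ (m - 1) * (t * real n) ^ (l - 1)"
      using ml by (cases m; cases l) (auto simp: power_add)
    also have "\<dots> \<le> real (n - 1) * falling_fact (n - 2) (m - 1) * falling_fact (n - 2) (l - 1)"
      using t n tn ml by (intro mult_mono ge) (auto simp: of_nat_diff)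
    finally show "t ^ (2 * k) * (real n * p) ^ (m + l - 1) \<le> real (n - 1) * falling_fact (n - 2) (m - 1) * falling_fact (n - 2) (l - 1) * p ^ (m + l - 1)"
      using p unfolding power_mult_distrib mult.assoc[symmetric] by (intro mult_right_mono) auto
  next
    fix m l s assume mls: "m \<in> {1..k}" "l \<in> {1..k}" "s \<in> {1..min m l}"
    have "t ^ (2 * k) * real n ^ (m + l - s) \<le> (t * real n) ^ (m + l - s)" using mls by (intro pw) auto
    also have "\<dots> \<le> falling_fact (n - 1) (m + l - s)"
    proof -
      have "real (n - 1) - real (2 * k + 1) = t * real n" using n tn by (simp add: of_nat_diff)
      moreover have "m + l - s \<le> 2 * k + 1" "2 * k + 1 \<le> n - 1" using n mls by auto
      ultimately show ?thesis using falling_fact_ge[of "m + l - s" "2 * k + 1" "n - 1"] by simp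
    qed
    finally show "t ^ (2 * k) * (real n * p) ^ (m + l - s) \<le> falling_fact (n - 1) (m + l - s) * p ^ (m + l - s)"
      using p unfolding power_mult_distrib mult.assoc[symmetric] by (intro mult_right_mono) auto
  qed (use p in \<open>auto intro: power_le_one\<close>)
  finally show ?thesis by (simp add: t_def)
qed

text \<open>All summands are nonnegative and two of them suffice, with \<open>x = n p\<close>:
  \<open>m = l = 1\<close> gives at least \<open>x (1 - p)\<close>, which serves for
  \<open>x \<le> 1\<close>, and \<open>m = l = k\<close> gives at least
  \<open>x ^ (2 k - 1) (1 - p)\<close>, which serves for \<open>x > 1\<close>. Bounding the maximum
  of 1 and \<open>x\<close> below by their mean costs the powers of 2.\<close>

lemma zagreb_scale_sq_ge:
  assumes p: "0 \<le> p" "p \<le> 1" and k: "1 \<le> k"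
  shows "(real n)\<^sup>2 * p * (1 - p) * ((1 + real n * p) ^ (k - 1) / 2 ^ (k - 1))\<^sup>2 \<le> zagreb_scale_sq k n p"
proof -
  define x where "x = real n * p"
  have x: "0 \<le> x" using p by (simp add: x_def)
  define f where "f = (\<lambda>m l. real (Stirling k m) * real (Stirling k l) *
        (real m * real l * x ^ (m + l - 1) * (1 - p) +
         (\<Sum>s=1..min m l. stirling_coeff m l s * (x ^ (m + l - s) * (1 - p ^ s)))))"
  have inner: "0 \<le> (\<Sum>s=1..min m l. stirling_coeff m l s * (x ^ (m + l - s) * (1 - p ^ s)))" for m l
    using p x by (intro sum_nonneg mult_nonneg_nonneg) (auto intro: power_le_one)
  have f: "0 \<le> f m l" for m l
    unfolding f_def using p x inner by (intro mult_nonneg_nonneg add_nonneg_nonneg) auto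
  have diag: "f m m \<le> (\<Sum>m=1..k. \<Sum>l=1..k. f m l)" if "m \<in> {1..k}" for m
  proof -
    have "f m m \<le> (\<Sum>l=1..k. f m l)" using that f by (intro member_le_sum) auto
    also have "\<dots> \<le> (\<Sum>m=1..k. \<Sum>l=1..k. f m l)"
      using that f by (intro member_le_sum[of m _ "\<lambda>m. \<Sum>l=1..k. f m l"] sum_nonneg) auto
    finally show ?thesis .
  qed
  have "Stirling k 1 = 1" using k Stirling_1[of "k - 1"] by simp
  then have f1: "x * (1 - p) \<le> f 1 1" unfolding f_def using inner[of 1 1] by simp
  have "x * (1 - p) * x ^ (2 * (k - 1)) = x ^ (k + k - 1) * (1 - p)"
    using k by (cases k) (auto simp: power_add mult_2 mult_2_right algebra_simps)
  also have "\<dots> = 1 * (x ^ (k + k - 1) * (1 - p))" by simp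
  also have "\<dots> \<le> (real k * real k) * (x ^ (k + k - 1) * (1 - p))"
    using k p x mult_mono[of 1 "real k" 1 "real k"] by (intro mult_right_mono) auto
  also have "\<dots> \<le> f k k"
    unfolding f_def using inner[of k k] by (simp add: mult.assoc)
  finally have fk: "x * (1 - p) * x ^ (2 * (k - 1)) \<le> f k k" .
  have "((1 + x) ^ (k - 1) / 2 ^ (k - 1))\<^sup>2 = ((1 + x) / 2) ^ (2 * (k - 1))"
    by (simp add: power_divide power_mult mult.commute[of 2])
  also have "\<dots> \<le> max 1 (x ^ (2 * (k - 1)))"
  proof (cases "x \<le> 1")
    case True
    then show ?thesis using x by (simp add: le_max_iff_disj power_le_one)
  next
    case False
    then have "((1 + x) / 2) ^ (2 * (k - 1)) \<le> x ^ (2 * (k - 1))" by (intro power_mono) auto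
    then show ?thesis by simp
  qed
  finally have "x * (1 - p) * ((1 + x) ^ (k - 1) / 2 ^ (k - 1))\<^sup>2 \<le> x * (1 - p) * max 1 (x ^ (2 * (k - 1)))"
    using x p by (intro mult_left_mono) auto
  also have "\<dots> \<le> (\<Sum>m=1..k. \<Sum>l=1..k. f m l)"
    using f1 fk diag[of 1] diag[of k] k by (auto simp: max_def)
  finally have "real n * (x * (1 - p) * ((1 + x) ^ (k - 1) / 2 ^ (k - 1))\<^sup>2) \<le> real n * (\<Sum>m=1..k. \<Sum>l=1..k. f m l)"
    by (intro mult_left_mono) auto
  then show ?thesis by (simp add: zagreb_scale_sq_def f_def x_def power2_eq_square mult_ac)
qed

section \<open>The central limit theorem\<close>

lemma real_deriv_bound:
  fixes f f' :: "real \<Rightarrow> real"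
  assumes "\<And>x. (f has_real_derivative f' x) (at x)"
    and "convex S" "x \<in> S" "y \<in> S" "\<And>z. z \<in> S \<Longrightarrow> \<bar>f' z\<bar> \<le> B"
  shows "\<bar>f x - f y\<bar> \<le> B * \<bar>x - y\<bar>"
  using field_differentiable_bound[of S f f' B x y] assms
  by (auto intro: has_field_derivative_at_within)

lemma taylor_quadratic_bound:
  fixes h h' h'' :: "real \<Rightarrow> real"
  assumes h: "\<And>x. (h has_real_derivative h' x) (at x)"
    and h': "\<And>x. (h' has_real_derivative h'' x) (at x)" "\<And>x. \<bar>h'' x\<bar> \<le> 1"
  shows "\<bar>h y - h x - h' x * (y - x)\<bar> \<le> (y - x)\<^sup>2"
proof -
  have "\<bar>(h y - h' x * y) - (h x - h' x * x)\<bar> \<le> \<bar>y - x\<bar> * \<bar>y - x\<bar>"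
  proof (rule real_deriv_bound[where f = "\<lambda>z. h z - h' x * z" and f' = "\<lambda>z. h' z - h' x"
        and S = "closed_segment x y"])
    show "((\<lambda>z. h z - h' x * z) has_real_derivative h' z - h' x) (at z)" for z
      by (auto intro!: derivative_eq_intros h)
    fix z assume z: "z \<in> closed_segment x y"
    have "\<bar>h' z - h' x\<bar> \<le> 1 * \<bar>z - x\<bar>"
      by (rule real_deriv_bound[where S = UNIV, OF h'(1)]) (auto simp: h'(2))
    also have "\<bar>z - x\<bar> \<le> \<bar>y - x\<bar>" using z by (auto simp: closed_segment_eq_real_ivl split: if_splits)
    finally show "\<bar>h' z - h' x\<bar> \<le> \<bar>y - x\<bar>" by simp
  qed auto
  then show ?thesis by (simp add: power2_eq_square algebra_simps flip: abs_mult)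
qed

text \<open>Integrating factor: \<open>u s * exp (s\<^sup>2 / 2)\<close> has derivative
  \<open>(u' s + s * u s) * exp (s\<^sup>2 / 2)\<close>. The mean value bound on the interval of
  radius \<open>\<bar>t\<bar>\<close> loses a factor \<open>exp (t\<^sup>2 / 2)\<close>, which
  cancels at the end.\<close>

lemma gauss_ode_bound:
  fixes u u' :: "real \<Rightarrow> real"
  assumes u: "\<And>s. (u has_real_derivative u' s) (at s)"
    and K: "\<And>s. \<bar>s\<bar> \<le> \<bar>t\<bar> \<Longrightarrow> \<bar>u' s + s * u s\<bar> \<le> K"
  shows "\<bar>u t - u 0 * exp (- t\<^sup>2 / 2)\<bar> \<le> K * \<bar>t\<bar>"
proof -
  have "\<bar>u t * exp (t\<^sup>2 / 2) - u 0 * exp (0\<^sup>2 / 2)\<bar> \<le> (K * exp (t\<^sup>2 / 2)) * \<bar>t - 0\<bar>"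
  proof (rule real_deriv_bound[where f = "\<lambda>s. u s * exp (s\<^sup>2 / 2)" and S = "{- \<bar>t\<bar>..\<bar>t\<bar>}"
        and f' = "\<lambda>s. (u' s + s * u s) * exp (s\<^sup>2 / 2)"])
    show "((\<lambda>s. u s * exp (s\<^sup>2 / 2)) has_real_derivative (u' s + s * u s) * exp (s\<^sup>2 / 2)) (at s)" for s
      by (auto intro!: derivative_eq_intros u simp: algebra_simps)
    fix s assume "s \<in> {- \<bar>t\<bar>..\<bar>t\<bar>}"
    then have s: "\<bar>s\<bar> \<le> \<bar>t\<bar>" by auto
    then have "s\<^sup>2 \<le> t\<^sup>2" by (simp add: abs_le_square_iff)
    then show "\<bar>(u' s + s * u s) * exp (s\<^sup>2 / 2)\<bar> \<le> K * exp (t\<^sup>2 / 2)"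
      unfolding abs_mult using K[OF s] by (intro mult_mono) auto
  qed auto
  also have "u t * exp (t\<^sup>2 / 2) - u 0 * exp (0\<^sup>2 / 2) = exp (t\<^sup>2 / 2) * (u t - u 0 * exp (- t\<^sup>2 / 2))"
    by (simp add: algebra_simps flip: exp_add)
  finally have "exp (t\<^sup>2 / 2) * \<bar>u t - u 0 * exp (- t\<^sup>2 / 2)\<bar> \<le> exp (t\<^sup>2 / 2) * (K * \<bar>t\<bar>)"
    by (simp add: abs_mult mult_ac)
  then show ?thesis by simp
qed

lemma bexp_has_derivative:
  assumes "finite E" "\<And>A. ((\<lambda>s. f s A) has_real_derivative f' s A) (at s)"
  shows "((\<lambda>s. bexp p E (f s)) has_real_derivative bexp p E (f' s)) (at s)"
proof -
  have "bexp p E F = (\<Sum>A\<in>Pow E. pmf (random_subset p E) A * F A)" for F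
    unfolding bexp_def using set_random_subset_subset[OF assms(1), of p] assms(1)
    by (subst integral_measure_pmf[of "Pow E"]) auto
  then show ?thesis by (auto intro!: derivative_eq_intros assms(2) sum.cong)
qed

text \<open>The first summand pays for the scale not being the exact standard deviation, the second
  for the Stein bound: 6 is its factor 3 times the 2 of \<open>2 * n\<close> adjacent edges, and
  each \<open>2 ^ (k - 1)\<close> is the loss in the lower bound for the scale.\<close>

definition clt_error :: "nat \<Rightarrow> nat \<Rightarrow> real \<Rightarrow> real \<Rightarrow> real" where
  "clt_error k n p t =
    t * (1 - ((real n - real (2 * k + 2)) / real n) ^ (2 * k))
    + (6 * t * (discrete_deriv_const k * 2 ^ (k - 1))\<^sup>2 + t\<^sup>2 * (discrete_deriv_const k * 2 ^ (k - 1)) ^ 3) / sqrt ((real n)\<^sup>2 * p * (1 - p))"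

lemma zagreb_scale_ge:
  assumes p: "0 \<le> p" "p \<le> 1" and k: "1 \<le> k"
  shows "sqrt ((real n)\<^sup>2 * p * (1 - p)) * ((1 + real n * p) ^ (k - 1) / 2 ^ (k - 1)) \<le> zagreb_scale k n p"
proof -
  have "sqrt ((real n)\<^sup>2 * p * (1 - p)) * ((1 + real n * p) ^ (k - 1) / 2 ^ (k - 1))
    = sqrt ((real n)\<^sup>2 * p * (1 - p) * ((1 + real n * p) ^ (k - 1) / 2 ^ (k - 1))\<^sup>2)"
    using p by (simp only: real_sqrt_mult real_sqrt_abs) simp
  then show ?thesis
    unfolding zagreb_scale_eq by (simp only: real_sqrt_le_iff zagreb_scale_sq_ge[OF p k])
qed

lemma zagreb_scale_pos:
  assumes "0 < p" "p < 1" "1 \<le> k" "1 \<le> n"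
  shows "0 < zagreb_scale k n p"
proof -
  have "0 < sqrt ((real n)\<^sup>2 * p * (1 - p)) * ((1 + real n * p) ^ (k - 1) / 2 ^ (k - 1))"
    using assms by (intro mult_pos_pos divide_pos_pos zero_less_power add_pos_nonneg) auto
  then show ?thesis using zagreb_scale_ge[of p k n] assms by linarith
qed

text \<open>Meant for sin and cos: up to sign the two expectations are then the derivative of one of
  the two parts (real or imaginary) of the characteristic function of \<open>W\<close>, and that
  part itself.\<close>

lemma normalized_stein_bound:
  fixes h h' h'' :: "real \<Rightarrow> real"
  assumes p: "0 < p" "p < 1" and k: "1 \<le> k" and n: "2 * k + 2 \<le> n"
    and h: "\<And>x. (h has_real_derivative h' x) (at x)" "\<And>x. (h' has_real_derivative h'' x) (at x)"
    and hb: "\<And>x. \<bar>h' x\<bar> \<le> 1" "\<And>x. \<bar>h'' x\<bar> \<le> 1"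
    and s: "\<bar>s\<bar> \<le> t"
    and W: "\<And>A. W A = (degree_power_sum k n A - zagreb_center k n p) / zagreb_scale k n p"
  shows "\<bar>bexp p (possible_edges n) (\<lambda>A. W A * h (s * W A)) - s * bexp p (possible_edges n) (\<lambda>A. h' (s * W A))\<bar>
    \<le> clt_error k n p t"
proof -
  define E where "E = possible_edges n"
  define F where "F = degree_power_sum k n"
  define \<mu> where "\<mu> = zagreb_center k n p"
  define \<sigma> where "\<sigma> = zagreb_scale k n p"
  define d where "d = sqrt ((real n)\<^sup>2 * p * (1 - p))"
  define l where "l = (1 + real n * p) ^ (k - 1)"
  define K where "K = discrete_deriv_const k"
  define C where "C = (2 :: real) ^ (k - 1)"
  define a where "a = K * l"
  define b where "b = K * l / (1 + real n * p)"
  define r where "r = p * (1 - p)"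
  have p': "0 \<le> p" "p \<le> 1" and n1: "1 \<le> n" using p n by auto
  have lam: "1 \<le> 1 + real n * p" using p by simp
  have l: "1 \<le> l" unfolding l_def by (rule one_le_power[OF lam])
  have K: "1 \<le> K" unfolding K_def by (rule discrete_deriv_const_ge_1)
  have C: "1 \<le> C" unfolding C_def by simp
  have d: "0 < d" using p n1 by (simp add: d_def)
  have d2: "d\<^sup>2 = (real n)\<^sup>2 * r" using p by (simp add: d_def r_def)
  have r: "0 \<le> r" using p by (simp add: r_def)
  have \<sigma>: "0 < \<sigma>" unfolding \<sigma>_def by (rule zagreb_scale_pos[OF p k n1])
  have \<sigma>_ge: "d * l / C \<le> \<sigma>"
    using zagreb_scale_ge[OF p' k, of n] by (simp add: d_def l_def C_def \<sigma>_def)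
  have ab: "0 < b" "b \<le> a"
  proof -
    show "0 < b" unfolding b_def using l K lam by (intro divide_pos_pos mult_pos_pos) auto
    have "K * l / (1 + real n * p) \<le> K * l / 1" using l K lam by (intro divide_left_mono) auto
    then show "b \<le> a" by (simp add: a_def b_def)
  qed
  have \<mu>: "bexp p E F = \<mu>" unfolding E_def F_def \<mu>_def by (rule bexp_degree_power_sum[OF p' k])
  define V where "V = bcov p E F F"
  have V: "V = zagreb_var k n p" unfolding V_def E_def F_def by (rule bcov_degree_power_sum[OF p' k])
  have t: "0 \<le> t" using s by linarith
  have card: "real (card E) \<le> (real n)\<^sup>2"
    unfolding E_def of_nat_power[symmetric] of_nat_le_iff by (rule card_possible_edges_le)
  \<comment> \<open>The test function in the unnormalized variable; each derivative brings a factor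
    \<open>s / \<sigma>\<close>, whence the constants \<open>t / \<sigma>\<close> and
    \<open>(t / \<sigma>)\<^sup>2\<close>.\<close>
  let ?g = "\<lambda>x. h (s * ((x - \<mu>) / \<sigma>))" and ?g' = "\<lambda>x. s / \<sigma> * h' (s * ((x - \<mu>) / \<sigma>))"
  have "\<bar>bexp p E (\<lambda>X. (F X - bexp p E F) * ?g (F X)) - bcov p E F F * bexp p E (\<lambda>X. ?g' (F X))\<bar>
    \<le> (t / \<sigma>) * (3 * (p * (1 - p) * (2 * real n) * a * b) * sqrt (p * (1 - p) * real (card E)))
      + (t / \<sigma>)\<^sup>2 * (p * (1 - p) * real (card E) * a ^ 3)"
  proof (rule stein_bound[where N = "\<lambda>e. {j \<in> possible_edges n. j \<inter> e \<noteq> {}}"])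
    show "finite E" by (simp add: E_def)
    show "bexp p E (\<lambda>X. discrete_deriv j F X ^ 4) \<le> a ^ 4" if "j \<in> E" for j
      using bexp_discrete_deriv_le[OF p' _ k] that unfolding E_def F_def a_def K_def l_def by blast
    show "bexp p E (\<lambda>X. discrete_deriv e (discrete_deriv j F) X ^ 4) \<le> b ^ 4" if "j \<in> E" for e j
      using bexp_discrete_deriv_discrete_deriv_le[OF p' _ k] that unfolding E_def F_def b_def K_def l_def by blast
    show "real (card {j \<in> possible_edges n. j \<inter> e \<noteq> {}}) \<le> 2 * real n" if "e \<in> E" for e
      using card_adjacent_edges that unfolding E_def .
    show "discrete_deriv e (discrete_deriv j F) X = 0"
      if "e \<in> E" "j \<in> E - {j \<in> possible_edges n. j \<inter> e \<noteq> {}}" "X \<subseteq> E" for e j X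
    proof -
      have "finite X" "j \<in> possible_edges n" using that unfolding E_def by (auto intro: finite_subset)
      then show ?thesis unfolding F_def using that
        by (subst discrete_deriv_discrete_deriv_degree_power_sum) (auto simp: E_def intro!: sum.neutral)
    qed
    show "\<bar>?g y - ?g x - ?g' x * (y - x)\<bar> \<le> (t / \<sigma>)\<^sup>2 * (y - x)\<^sup>2" for x y
    proof -
      have "?g' x * (y - x) = h' (s * ((x - \<mu>) / \<sigma>)) * (s * ((y - \<mu>) / \<sigma>) - s * ((x - \<mu>) / \<sigma>))"
        using \<sigma> by (simp add: field_simps)
      then have "\<bar>?g y - ?g x - ?g' x * (y - x)\<bar> \<le> (s * ((y - \<mu>) / \<sigma>) - s * ((x - \<mu>) / \<sigma>))\<^sup>2"
        using taylor_quadratic_bound[of h h' h'', OF h hb(2)] by simp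
      also have "s * ((y - \<mu>) / \<sigma>) - s * ((x - \<mu>) / \<sigma>) = s / \<sigma> * (y - x)"
        using \<sigma> by (simp add: field_simps)
      also have "(s / \<sigma> * (y - x))\<^sup>2 = s\<^sup>2 / \<sigma>\<^sup>2 * (y - x)\<^sup>2" by (simp add: power_mult_distrib power_divide)
      also have "\<dots> \<le> t\<^sup>2 / \<sigma>\<^sup>2 * (y - x)\<^sup>2"
        using s t by (intro mult_right_mono divide_right_mono) (auto simp flip: abs_le_square_iff)
      finally show ?thesis by (simp add: power_divide)
    qed
    show "\<bar>?g' x\<bar> \<le> t / \<sigma>" for x
    proof -
      have "\<bar>?g' x\<bar> = \<bar>s\<bar> / \<sigma> * \<bar>h' (s * ((x - \<mu>) / \<sigma>))\<bar>" using \<sigma> by (simp add: abs_mult)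
      also have "\<dots> \<le> t / \<sigma> * 1" using s t \<sigma> hb(1) by (intro mult_mono divide_right_mono) auto
      finally show ?thesis by simp
    qed
  qed (use p' ab in \<open>auto simp: E_def\<close>)
  also have "bexp p E (\<lambda>X. (F X - bexp p E F) * ?g (F X)) = \<sigma> * bexp p E (\<lambda>A. W A * h (s * W A))"
    using \<sigma> by (simp add: bexp_cmult[symmetric] W F_def \<mu>[unfolded F_def] flip: \<mu>_def \<sigma>_def)
  also have "bexp p E (\<lambda>X. ?g' (F X)) = s / \<sigma> * bexp p E (\<lambda>A. h' (s * W A))"
    unfolding bexp_cmult by (simp add: W F_def flip: \<mu>_def \<sigma>_def)
  also have "p * (1 - p) = r" by (simp add: r_def)
  finally have main: "\<bar>\<sigma> * bexp p E (\<lambda>A. W A * h (s * W A)) - V * (s / \<sigma> * bexp p E (\<lambda>A. h' (s * W A)))\<bar>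
    \<le> (t / \<sigma>) * (3 * (r * (2 * real n) * a * b) * sqrt (r * real (card E))) + (t / \<sigma>)\<^sup>2 * (r * real (card E) * a ^ 3)"
    by (simp add: V_def)
  have div: "\<bar>x / \<sigma>\<bar> = \<bar>x\<bar> / \<sigma>" for x using \<sigma> by simp
  have "bexp p E (\<lambda>A. W A * h (s * W A)) - V / \<sigma>\<^sup>2 * (s * bexp p E (\<lambda>A. h' (s * W A)))
    = (\<sigma> * bexp p E (\<lambda>A. W A * h (s * W A)) - V * (s / \<sigma> * bexp p E (\<lambda>A. h' (s * W A)))) / \<sigma>"
    using \<sigma> by (simp add: field_simps power2_eq_square)
  then have "\<bar>bexp p E (\<lambda>A. W A * h (s * W A)) - V / \<sigma>\<^sup>2 * (s * bexp p E (\<lambda>A. h' (s * W A)))\<bar>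
    \<le> ((t / \<sigma>) * (3 * (r * (2 * real n) * a * b) * sqrt (r * real (card E))) + (t / \<sigma>)\<^sup>2 * (r * real (card E) * a ^ 3)) / \<sigma>"
    using main \<sigma> by (simp add: div divide_right_mono)
  also have "\<dots> = 6 * t * ((r * real n * a * b) * sqrt (r * real (card E)) / \<sigma>\<^sup>2) + t\<^sup>2 * (r * real (card E) * a ^ 3 / \<sigma> ^ 3)"
    using \<sigma> by (simp add: field_simps power2_eq_square power3_eq_cube)
  also have "\<dots> \<le> 6 * t * ((K * C)\<^sup>2 / d) + t\<^sup>2 * ((K * C) ^ 3 / d)"
  proof (intro add_mono mult_left_mono)
    have \<sigma>C: "d * l \<le> \<sigma> * C" using \<sigma>_ge C by (simp add: field_simps)
    \<comment> \<open>The balance of the method: the number of adjacent edges times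
      \<open>p * (1 - p)\<close> is at most of order \<open>1 + n p\<close> and cancels the
      denominator of \<open>b\<close>.\<close>
    have rn: "r * real n \<le> 1 + real n * p"
    proof -
      have "r * real n = (real n * p) * (1 - p)" by (simp add: r_def)
      also have "\<dots> \<le> (real n * p) * 1" using p by (intro mult_left_mono) auto
      finally show ?thesis by simp
    qed
    have rc: "r * real (card E) \<le> d\<^sup>2" using card r by (simp add: d2 mult.commute mult_left_mono)
    have "r * real n * a * b = (r * real n) * (K * l)\<^sup>2 / (1 + real n * p)"
      by (simp add: a_def b_def power2_eq_square)
    also have "\<dots> \<le> (1 + real n * p) * (K * l)\<^sup>2 / (1 + real n * p)"
      using rn lam by (intro divide_right_mono mult_right_mono) auto
    also have "\<dots> = (K * l)\<^sup>2" using lam by simp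
    finally have "r * real n * a * b \<le> (K * l)\<^sup>2" .
    moreover have "sqrt (r * real (card E)) \<le> d" using rc d by (simp add: real_le_lsqrt)
    ultimately have "(r * real n * a * b) * sqrt (r * real (card E)) * d \<le> (K * l)\<^sup>2 * d * d"
      using d r by (intro mult_right_mono mult_mono) auto
    also have "\<dots> = K\<^sup>2 * (d * l)\<^sup>2" by (simp add: power2_eq_square)
    also have "\<dots> \<le> K\<^sup>2 * (\<sigma> * C)\<^sup>2" using d l \<sigma>C by (intro mult_left_mono power_mono) auto
    finally show "(r * real n * a * b) * sqrt (r * real (card E)) / \<sigma>\<^sup>2 \<le> (K * C)\<^sup>2 / d"
      using d \<sigma> by (simp add: field_simps)
    have "r * real (card E) * a ^ 3 * d \<le> d\<^sup>2 * a ^ 3 * d"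
      using rc d ab by (intro mult_right_mono) auto
    also have "\<dots> = K ^ 3 * (d * l) ^ 3" by (simp add: a_def power2_eq_square power3_eq_cube)
    also have "\<dots> \<le> K ^ 3 * (\<sigma> * C) ^ 3" using d l K \<sigma>C by (intro mult_left_mono power_mono) auto
    finally show "r * real (card E) * a ^ 3 / \<sigma> ^ 3 \<le> (K * C) ^ 3 / d"
      using d \<sigma> by (simp add: field_simps)
  qed (use t in auto)
  finally have 1: "\<bar>bexp p E (\<lambda>A. W A * h (s * W A)) - V / \<sigma>\<^sup>2 * (s * bexp p E (\<lambda>A. h' (s * W A)))\<bar>
    \<le> 6 * t * ((K * C)\<^sup>2 / d) + t\<^sup>2 * ((K * C) ^ 3 / d)" .
  \<comment> \<open>\<open>V / \<sigma>\<^sup>2\<close> lies between \<open>\<rho>\<close> and 1;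
    replacing it by 1 produces the first summand of the error.\<close>
  define \<rho> where "\<rho> = ((real n - real (2 * k + 2)) / real n) ^ (2 * k)"
  have \<sigma>2: "\<sigma>\<^sup>2 = zagreb_scale_sq k n p"
  proof -
    have "0 < zagreb_scale_sq k n p" using \<sigma> by (simp add: \<sigma>_def zagreb_scale_eq)
    then show ?thesis by (simp add: \<sigma>_def zagreb_scale_eq)
  qed
  have "\<rho> * \<sigma>\<^sup>2 \<le> V" "V \<le> \<sigma>\<^sup>2"
    unfolding V \<sigma>2 \<rho>_def by (rule zagreb_var_ge[OF p' n], rule zagreb_var_le[OF p'])
  then have "\<rho> \<le> V / \<sigma>\<^sup>2" "V / \<sigma>\<^sup>2 \<le> 1" using \<sigma> by (auto simp: field_simps)
  then have 2: "\<bar>V / \<sigma>\<^sup>2 - 1\<bar> \<le> 1 - \<rho>" by simp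
  have 3: "\<bar>s * bexp p E (\<lambda>A. h' (s * W A))\<bar> \<le> t"
  proof -
    have "\<bar>bexp p E (\<lambda>A. h' (s * W A))\<bar> \<le> bexp p E (\<lambda>A. \<bar>h' (s * W A)\<bar>)"
      by (rule bexp_abs_le) (simp add: E_def)
    also have "\<dots> \<le> bexp p E (\<lambda>A. 1)" by (intro bexp_mono hb(1)) (simp add: E_def)
    finally have "\<bar>s\<bar> * \<bar>bexp p E (\<lambda>A. h' (s * W A))\<bar> \<le> t * 1" using s t by (intro mult_mono) auto
    then show ?thesis by (simp add: abs_mult)
  qed
  have 4: "\<bar>(V / \<sigma>\<^sup>2 - 1) * (s * bexp p E (\<lambda>A. h' (s * W A)))\<bar> \<le> (1 - \<rho>) * t"
    unfolding abs_mult[of "V / \<sigma>\<^sup>2 - 1"] using 2 3 by (intro mult_mono) auto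
  have "\<bar>bexp p E (\<lambda>A. W A * h (s * W A)) - s * bexp p E (\<lambda>A. h' (s * W A))\<bar>
    \<le> (1 - \<rho>) * t + (6 * t * ((K * C)\<^sup>2 / d) + t\<^sup>2 * ((K * C) ^ 3 / d))"
  proof -
    have "\<bar>x - z\<bar> \<le> e2 + e1" if "\<bar>x - y * z\<bar> \<le> e1" "\<bar>(y - 1) * z\<bar> \<le> e2" for x y z e1 e2 :: real
      using that unfolding left_diff_distrib by linarith
    from this[OF 1 4] show ?thesis .
  qed
  then show ?thesis
    by (simp add: clt_error_def E_def \<rho>_def K_def C_def d_def add_divide_distrib mult.commute)
qed

lemma clt_error_tendsto:
  assumes "filterlim (\<lambda>n. (real n)\<^sup>2 * p n * (1 - p n)) at_top sequentially"
  shows "(\<lambda>n. clt_error k n (p n) t) \<longlonglongrightarrow> 0"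
proof -
  have "(\<lambda>n. (real n - real (2 * k + 2)) / real n) \<longlonglongrightarrow> 1"
    by real_asymp
  then have 1: "(\<lambda>n. t * (1 - ((real n - real (2 * k + 2)) / real n) ^ (2 * k))) \<longlonglongrightarrow> t * (1 - 1 ^ (2 * k))"
    by (intro tendsto_intros)
  have "filterlim (\<lambda>n. sqrt ((real n)\<^sup>2 * p n * (1 - p n))) at_top sequentially"
    using sqrt_at_top assms by (rule filterlim_compose)
  then have "(\<lambda>n. (6 * t * (discrete_deriv_const k * 2 ^ (k - 1))\<^sup>2 + t\<^sup>2 * (discrete_deriv_const k * 2 ^ (k - 1)) ^ 3) / sqrt ((real n)\<^sup>2 * p n * (1 - p n))) \<longlonglongrightarrow> 0"
    by (intro real_tendsto_divide_at_top[OF tendsto_const])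
  from tendsto_add[OF 1 this] show ?thesis by (simp add: clt_error_def)
qed

lemma char_distr_random_subset:
  assumes "finite E"
  shows "char (distr (measure_pmf (random_subset p E)) borel W) t =
    complex_of_real (bexp p E (\<lambda>A. cos (t * W A))) + \<i> * complex_of_real (bexp p E (\<lambda>A. sin (t * W A)))"
proof -
  have fin: "finite (set_pmf (random_subset p E))" by (rule finite_set_random_subset[OF assms])
  have int: "integrable (measure_pmf (random_subset p E)) f" for f :: "_ \<Rightarrow> complex"
    using fin by (rule integrable_measure_pmf_finite)
  have "char (distr (measure_pmf (random_subset p E)) borel W) t = measure_pmf.expectation (random_subset p E) (\<lambda>A. iexp (t * W A))"
    unfolding char_def by (subst integral_distr) auto
  also have "(\<lambda>A. iexp (t * W A)) = (\<lambda>A. complex_of_real (cos (t * W A)) + \<i> * complex_of_real (sin (t * W A)))"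
    by (simp add: exp_Euler flip: cos_of_real sin_of_real)
  also have "measure_pmf.expectation (random_subset p E) \<dots> =
    measure_pmf.expectation (random_subset p E) (\<lambda>A. complex_of_real (cos (t * W A)))
    + \<i> * measure_pmf.expectation (random_subset p E) (\<lambda>A. complex_of_real (sin (t * W A)))"
    by (simp add: Bochner_Integration.integral_add[OF int int])
  finally show ?thesis by (simp add: bexp_def)
qed

lemma zagreb_clt:
  fixes p :: "nat \<Rightarrow> real"
  assumes k: "1 \<le> k" and p: "\<And>n. 1 \<le> n \<Longrightarrow> 0 < p n \<and> p n < 1"
    and lim: "filterlim (\<lambda>n. (real n)\<^sup>2 * p n * (1 - p n)) at_top sequentially"
  shows "weak_conv_m
      (\<lambda>n. distr (measure_pmf (gnp n (p n))) borel
         (\<lambda>G. (zagreb k n G - zagreb_center k n (p n)) / zagreb_scale k n (p n)))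
      std_normal_distribution"
proof (rule levy_continuity)
  fix n
  show "real_distribution (distr (measure_pmf (gnp n (p n))) borel
         (\<lambda>G. (zagreb k n G - zagreb_center k n (p n)) / zagreb_scale k n (p n)))"
    by (intro prob_space.real_distribution_distr measure_pmf.prob_space_axioms) simp
next
  show "real_distribution std_normal_distribution" by (rule real_dist_normal_dist)
next
  fix t :: real
  define W where "W = (\<lambda>n A. (degree_power_sum k n A - zagreb_center k n (p n)) / zagreb_scale k n (p n))"
  define c where "c = (\<lambda>n t. bexp (p n) (possible_edges n) (\<lambda>A. cos (t * W n A)))"
  define s where "s = (\<lambda>n t. bexp (p n) (possible_edges n) (\<lambda>A. sin (t * W n A)))"
  let ?err = "\<lambda>n. clt_error k n (p n) \<bar>t\<bar> * \<bar>t\<bar>"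
  have err: "?err \<longlonglongrightarrow> 0"
    by (rule tendsto_mult_left_zero[OF clt_error_tendsto[OF lim]])
  have char: "char (distr (measure_pmf (gnp n (p n))) borel
         (\<lambda>G. (zagreb k n G - zagreb_center k n (p n)) / zagreb_scale k n (p n))) t
      = complex_of_real (c n t) + \<i> * complex_of_real (s n t)" for n
    unfolding gnp_eq_random_subset char_distr_random_subset[OF finite_possible_edges] c_def s_def W_def
    by (intro arg_cong2[where f="(+)"] arg_cong2[where f="(*)"] arg_cong[where f=complex_of_real] refl bexp_cong)
       (auto simp: zagreb_eq)
  \<comment> \<open>From \<open>2 * k + 2\<close> on the variance can be compared with the scale;
    the finitely many smaller \<open>n\<close> do not affect the limit.\<close>
  have bounds: "\<bar>c n t - exp (- t\<^sup>2 / 2)\<bar> \<le> ?err n \<and> \<bar>s n t\<bar> \<le> ?err n" if n: "2 * k + 2 \<le> n" for n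
  proof -
    have pn: "0 < p n" "p n < 1" using p[of n] n by auto
    note stein = normalized_stein_bound[OF pn k n]
    \<comment> \<open>The real part uses \<open>h = sin\<close>, as the derivative of
      \<open>cos (z W)\<close> in \<open>z\<close> is \<open>- W sin (z W)\<close>; its initial
      value is 1.\<close>
    have "\<bar>c n t - c n 0 * exp (- t\<^sup>2 / 2)\<bar> \<le> ?err n"
    proof (rule gauss_ode_bound)
      fix z
      show "(c n has_real_derivative - bexp (p n) (possible_edges n) (\<lambda>A. W n A * sin (z * W n A))) (at z)"
      proof -
        have "((\<lambda>z. bexp (p n) (possible_edges n) (\<lambda>A. cos (z * W n A))) has_real_derivative
            bexp (p n) (possible_edges n) (\<lambda>A. - 1 * (W n A * sin (z * W n A)))) (at z)"
          by (rule bexp_has_derivative[OF finite_possible_edges]) (auto intro!: derivative_eq_intros)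
        then show ?thesis unfolding bexp_cmult c_def by simp
      qed
      assume "\<bar>z\<bar> \<le> \<bar>t\<bar>"
      then show "\<bar>- bexp (p n) (possible_edges n) (\<lambda>A. W n A * sin (z * W n A)) + z * c n z\<bar> \<le> clt_error k n (p n) \<bar>t\<bar>"
        using stein[of sin cos "\<lambda>x. - sin x" z "\<bar>t\<bar>" "W n"]
        by (simp add: c_def W_def DERIV_sin DERIV_cos abs_minus_commute)
    qed
    \<comment> \<open>The imaginary part uses \<open>h = cos\<close>; its initial value is 0, so
      only the error remains.\<close>
    moreover have "\<bar>s n t - s n 0 * exp (- t\<^sup>2 / 2)\<bar> \<le> ?err n"
    proof (rule gauss_ode_bound)
      fix z
      show "(s n has_real_derivative bexp (p n) (possible_edges n) (\<lambda>A. W n A * cos (z * W n A))) (at z)"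
        unfolding s_def
        by (rule bexp_has_derivative[OF finite_possible_edges]) (auto intro!: derivative_eq_intros)
      assume "\<bar>z\<bar> \<le> \<bar>t\<bar>"
      moreover have "((\<lambda>x. - sin x) has_real_derivative - cos x) (at x)" for x :: real
        by (auto intro!: derivative_eq_intros)
      moreover have "bexp (p n) (possible_edges n) (\<lambda>A. - sin (z * W n A)) = - s n z"
        using bexp_cmult[of "p n" "possible_edges n" "-1"] by (simp add: s_def)
      ultimately show "\<bar>bexp (p n) (possible_edges n) (\<lambda>A. W n A * cos (z * W n A)) + z * s n z\<bar> \<le> clt_error k n (p n) \<bar>t\<bar>"
        using stein[of cos "\<lambda>x. - sin x" "\<lambda>x. - cos x" z "\<bar>t\<bar>" "W n"]
        by (simp add: W_def DERIV_cos)
    qed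
    ultimately show ?thesis by (simp add: c_def s_def)
  qed
  have "(\<lambda>n. c n t - exp (- t\<^sup>2 / 2)) \<longlonglongrightarrow> 0" "(\<lambda>n. s n t) \<longlonglongrightarrow> 0"
    using bounds by (auto intro!: Lim_null_comparison[OF _ err] eventually_sequentiallyI[of "2 * k + 2"])
  show "(\<lambda>n. char (distr (measure_pmf (gnp n (p n))) borel
         (\<lambda>G. (zagreb k n G - zagreb_center k n (p n)) / zagreb_scale k n (p n))) t)
      \<longlonglongrightarrow> char std_normal_distribution t"
  proof -
    have "(\<lambda>n. c n t) \<longlonglongrightarrow> exp (- t\<^sup>2 / 2)"
      using \<open>(\<lambda>n. c n t - exp (- t\<^sup>2 / 2)) \<longlonglongrightarrow> 0\<close> by (simp add: LIM_zero_iff)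
    from tendsto_add[OF tendsto_of_real[OF this] tendsto_mult[OF tendsto_const[of \<i>] tendsto_of_real[OF \<open>(\<lambda>n. s n t) \<longlonglongrightarrow> 0\<close>]]]
    show ?thesis unfolding char char_std_normal_distribution by simp
  qed
qed

section \<open>The converse\<close>

text \<open>
  The quantiles \<open>t j\<close> of the continuous limit cut the line into pieces of small mass, uniformly for
  large \<open>n\<close>; every atom lies in a union of at most five of them.
\<close>
lemma weak_conv_m_atoms_vanish:
  fixes M :: "nat \<Rightarrow> real measure" and N :: "real measure"
  assumes M: "\<And>n. real_distribution (M n)" and N: "real_distribution N"
    and conv: "weak_conv_m M N" and cont: "\<And>x. isCont (cdf N) x" and c: "0 < c"
  shows "eventually (\<lambda>n. \<forall>x. measure (M n) {x} < c) sequentially"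
proof -
  interpret N: real_distribution N by fact
  \<comment> \<open>The 5 is the distance, in units of \<open>1 / r\<close>, between the bounds with
    \<open>i + 3\<close> and \<open>i - 2\<close> below.\<close>
  obtain r :: nat where r: "0 < r" "5 / real r < c"
  proof -
    obtain r :: nat where "5 / c < real r" using reals_Archimedean2 by blast
    moreover from this have "0 < real r" using c by (smt (verit) divide_pos_pos)
    ultimately show ?thesis using c by (intro that[of r]) (auto simp: field_simps)
  qed
  have "\<exists>t. cdf N t = real j / real r" if "j \<in> {1..<r}" for j
  proof -
    have j: "0 < real j / real r" "real j / real r < 1" using that by auto
    obtain x where x: "cdf N x < real j / real r"
      using order_tendstoD(2)[OF N.cdf_lim_at_bot j(1)] by (auto simp: eventually_at_bot_linorder)
    obtain y where y: "real j / real r < cdf N y"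
      using order_tendstoD(1)[OF N.cdf_lim_at_top_prob j(2)] by (auto simp: eventually_at_top_linorder)
    have "x \<le> y" using x y N.cdf_nondecreasing[of y x] by linarith
    then show ?thesis using IVT[of "cdf N" x "real j / real r" y] x y cont by auto
  qed
  then obtain t where t: "\<And>j. j \<in> {1..<r} \<Longrightarrow> cdf N (t j) = real j / real r" by metis
  have "eventually (\<lambda>n. \<forall>j\<in>{1..<r}. \<bar>cdf (M n) (t j) - real j / real r\<bar> < 1 / real r) sequentially"
  proof (intro eventually_ball_finite ballI)
    fix j assume j: "j \<in> {1..<r}"
    have "(\<lambda>n. cdf (M n) (t j)) \<longlonglongrightarrow> cdf N (t j)"
      using conv cont by (auto simp: weak_conv_m_def weak_conv_def)
    then show "eventually (\<lambda>n. \<bar>cdf (M n) (t j) - real j / real r\<bar> < 1 / real r) sequentially"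
      using r(1) unfolding tendsto_iff t[OF j] dist_real_def by (auto elim: allE[of _ "1 / real r"])
  qed auto
  then show ?thesis
  proof eventually_elim
    case (elim n)
    interpret M: real_distribution "M n" by (rule M)
    show ?case
    proof
      fix x
      \<comment> \<open>\<open>i / r\<close> is \<open>cdf N x\<close> rounded down. The quantile
        \<open>i + 2\<close> lies to the right of \<open>x\<close> and \<open>i - 1\<close> strictly
        to the left; the error \<open>1 / r\<close> of \<open>cdf (M n)\<close> at these points
        turns them into \<open>i + 3\<close> and \<open>i - 2\<close>. Where such a quantile does
        not exist, the upper bound is at least 1 or the lower one at most 0.\<close>
      define i where "i = nat \<lfloor>cdf N x * real r\<rfloor>"
      have v: "0 \<le> cdf N x" "cdf N x \<le> 1" by (rule N.cdf_nonneg, rule N.cdf_bounded_prob)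
      have i: "real i \<le> cdf N x * real r" "cdf N x * real r < real i + 1"
        using v r(1) by (auto simp: i_def)
      have up: "cdf (M n) x \<le> (real i + 3) / real r"
      proof (cases "i + 2 < r")
        case True
        have "cdf N x < cdf N (t (i + 2))"
          using True i r(1) by (subst t) (auto simp: field_simps)
        then have "x \<le> t (i + 2)" using N.cdf_nondecreasing[of "t (i + 2)" x] by linarith
        then have "cdf (M n) x \<le> cdf (M n) (t (i + 2))" by (rule M.cdf_nondecreasing)
        also have "\<dots> \<le> (real i + 3) / real r"
          using bspec[OF elim, of "i + 2"] True by (auto simp: abs_less_iff add_divide_distrib)
        finally show ?thesis .
      next
        case False
        have "cdf (M n) x \<le> 1" by (rule M.cdf_bounded_prob)
        also have "1 \<le> (real i + 3) / real r" using False r(1) by (simp add: field_simps)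
        finally show ?thesis .
      qed
      have low: "measure (M n) {..<x} \<ge> (real i - 2) / real r"
      proof (cases "2 \<le> i \<and> i \<le> r")
        case True
        then have mem: "i - 1 \<in> {1..<r}" by auto
        have "cdf N (t (i - 1)) < cdf N x"
          using True i r(1) by (subst t[OF mem]) (auto simp: field_simps of_nat_diff)
        then have "t (i - 1) < x" using N.cdf_nondecreasing[of x "t (i - 1)"] by linarith
        then have "cdf (M n) (t (i - 1)) \<le> measure (M n) {..<x}"
          unfolding cdf_def by (intro M.finite_measure_mono) auto
        moreover have "(real i - 2) / real r \<le> cdf (M n) (t (i - 1))"
          using bspec[OF elim mem] True by (auto simp: abs_less_iff add_divide_distrib diff_divide_distrib of_nat_diff)
        ultimately show ?thesis by linarith
      next
        case False
        moreover have "i \<le> r"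
        proof -
          have "cdf N x * real r \<le> 1 * real r" using v by (intro mult_right_mono) auto
          then show ?thesis using i by linarith
        qed
        ultimately have "(real i - 2) / real r \<le> 0" by (simp add: divide_nonpos_nonneg)
        then show ?thesis using measure_nonneg[of "M n" "{..<x}"] by linarith
      qed
      have "{..x} = {..<x} \<union> {x}" by auto
      then have "cdf (M n) x = measure (M n) {..<x} + measure (M n) {x}"
        unfolding cdf_def by (simp only:) (rule M.finite_measure_Union, auto)
      then have "measure (M n) {x} \<le> (real i + 3) / real r - (real i - 2) / real r"
        using up low by linarith
      also have "\<dots> = 5 / real r" by (simp add: diff_divide_distrib[symmetric])
      finally show "measure (M n) {x} < c" using r(2) by linarith
    qed
  qed
qed

lemma isCont_cdf_std_normal: "isCont (cdf std_normal_distribution) x"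
proof -
  interpret real_distribution std_normal_distribution by (rule real_dist_normal_dist)
  have "emeasure std_normal_distribution {x} = (\<integral>\<^sup>+y. ennreal (std_normal_density y) * indicator {x} y \<partial>lborel)"
    by (rule emeasure_density) auto
  also have "\<dots> = 0" by (intro nn_integral_null_set) (auto simp: null_sets_def)
  finally show ?thesis by (simp add: isCont_cdf measure_def)
qed

section \<open>Atoms of the random graph\<close>

lemma pmf_random_subset: "pmf (random_subset p E) A0 = bexp p E (\<lambda>A. of_bool (A = A0))"
proof -
  have "(\<lambda>A. of_bool (A = A0)) = (indicator {A0} :: _ \<Rightarrow> real)" by (auto simp: indicator_def)
  then show ?thesis by (simp add: bexp_def measure_pmf_single)
qed

lemma pmf_random_subset_empty:
  assumes "finite E" "0 \<le> p" "p \<le> 1"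
  shows "pmf (random_subset p E) {} = (1 - p) ^ card E"
  unfolding pmf_random_subset using assms(1)
  by (induction E rule: finite_induct) (simp_all add: bexp_insert assms)

lemma pmf_random_subset_full:
  assumes "finite E" "0 \<le> p" "p \<le> 1"
  shows "pmf (random_subset p E) E = p ^ card E"
  unfolding pmf_random_subset using assms(1)
proof (induction E rule: finite_induct)
  case (insert x E)
  have "bexp p E (\<lambda>A. of_bool (insert x A = insert x E)) = bexp p E (\<lambda>A. of_bool (A = E))"
    using insert.hyps by (intro bexp_cong) (auto simp: insert_ident subset_iff)
  moreover have "bexp p E (\<lambda>A. of_bool (A = insert x E)) = bexp p E (\<lambda>A. 0)"
    using insert.hyps by (intro bexp_cong) auto
  ultimately show ?case using insert by (simp add: bexp_insert assms)
qed simp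

lemma exp_le_one_minus:
  fixes x :: real assumes "0 \<le> x" "x \<le> 1 / 2"
  shows "exp (- 2 * x) \<le> 1 - x"
proof -
  have "0 \<le> x * (1 - 2 * x)" using assms by (intro mult_nonneg_nonneg) auto
  then have "1 \<le> (1 + 2 * x) * (1 - x)" by (simp add: algebra_simps)
  also have "\<dots> \<le> exp (2 * x) * (1 - x)"
    using assms by (intro mult_right_mono) auto
  finally show ?thesis by (simp add: exp_minus field_simps)
qed

text \<open>\<open>x\<close> stands for the smaller of \<open>p\<close> and \<open>1 - p\<close>.
  The 4 is two factors 2: \<open>1 - x \<ge> 1 / 2\<close> gives
  \<open>n\<^sup>2 x \<le> 2 C\<close>, and \<open>1 - x \<ge> exp (- 2 x)\<close> for such
  \<open>x\<close>.\<close>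

lemma power_card_ge:
  assumes x: "0 \<le> x" "x \<le> 1 / 2" and N: "N \<le> n\<^sup>2" and C: "(real n)\<^sup>2 * x * (1 - x) \<le> C"
  shows "exp (- 4 * C) \<le> (1 - x) ^ N"
proof -
  have "real N * x \<le> (real n)\<^sup>2 * x"
    using x N by (intro mult_right_mono) (auto simp flip: of_nat_power)
  also have "\<dots> \<le> 2 * ((real n)\<^sup>2 * x * (1 - x))"
    using x mult_left_mono[of "1 / 2" "1 - x" "(real n)\<^sup>2 * x"] by simp
  finally have "real N * x \<le> 2 * C" using C by linarith
  then have "- 4 * C \<le> real N * (- 2 * x)" by (simp add: mult.commute)
  then have "exp (- 4 * C) \<le> exp (real N * (- 2 * x))" by simp
  also have "\<dots> = exp (- 2 * x) ^ N" by (rule exp_of_nat_mult)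
  also have "\<dots> \<le> (1 - x) ^ N" using x exp_le_one_minus by (intro power_mono) auto
  finally show ?thesis .
qed

lemma gnp_large_atom:
  assumes p: "0 < p" "p < 1" and C: "(real n)\<^sup>2 * p * (1 - p) \<le> C"
  shows "\<exists>A. exp (- 4 * C) \<le> pmf (gnp n p) A"
proof (cases "p \<le> 1 / 2")
  case True
  then have "exp (- 4 * C) \<le> (1 - p) ^ card (possible_edges n)"
    using p C by (intro power_card_ge[of _ _ n] card_possible_edges_le) auto
  then show ?thesis using p by (intro exI[of _ "{}"]) (simp add: gnp_eq_random_subset pmf_random_subset_empty)
next
  case False
  then have "exp (- 4 * C) \<le> (1 - (1 - p)) ^ card (possible_edges n)"
    using p C by (intro power_card_ge[of _ _ n] card_possible_edges_le) (auto simp: mult_ac)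
  then show ?thesis using p by (intro exI[of _ "possible_edges n"]) (simp add: gnp_eq_random_subset pmf_random_subset_full)
qed

text \<open>Every statistic of the graph inherits its atom, so \<open>X\<close> may be any function;
  taking the normalized index for \<open>X\<close> treats all choices of \<open>a\<close> and
  \<open>b\<close> at once.\<close>

lemma variance_at_top_of_weak_conv:
  fixes p :: "nat \<Rightarrow> real" and X :: "nat \<Rightarrow> nat set set \<Rightarrow> real"
  assumes p: "\<And>n. 1 \<le> n \<Longrightarrow> 0 < p n \<and> p n < 1"
    and conv: "weak_conv_m (\<lambda>n. distr (measure_pmf (gnp n (p n))) borel (X n)) std_normal_distribution"
  shows "filterlim (\<lambda>n. (real n)\<^sup>2 * p n * (1 - p n)) at_top sequentially"
  unfolding filterlim_at_top
proof
  fix C :: real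
  have "eventually (\<lambda>n. \<forall>x. measure (distr (measure_pmf (gnp n (p n))) borel (X n)) {x} < exp (- 4 * C)) sequentially"
    by (intro weak_conv_m_atoms_vanish[OF _ real_dist_normal_dist conv] isCont_cdf_std_normal
        prob_space.real_distribution_distr measure_pmf.prob_space_axioms) auto
  with eventually_ge_at_top[of 1]
  show "eventually (\<lambda>n. C \<le> (real n)\<^sup>2 * p n * (1 - p n)) sequentially"
  proof eventually_elim
    case (elim n)
    show ?case
    proof (rule ccontr)
      assume "\<not> ?case"
      then obtain A where A: "exp (- 4 * C) \<le> pmf (gnp n (p n)) A"
        using gnp_large_atom[of "p n" n C] p[of n] elim by auto
      also have "\<dots> = measure_pmf.prob (gnp n (p n)) {A}" by (simp add: measure_pmf_single)
      also have "\<dots> \<le> measure_pmf.prob (gnp n (p n)) (X n -` {X n A})"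
        by (intro measure_pmf.finite_measure_mono) auto
      also have "\<dots> = measure (distr (measure_pmf (gnp n (p n))) borel (X n)) {X n A}"
        by (subst measure_distr) auto
      finally show False using elim by (meson not_less)
    qed
  qed
qed

theorem theorem3:
  fixes p :: "nat \<Rightarrow> real" and k :: nat
  assumes "k \<ge> 1"
    and "\<And>n. n \<ge> 1 \<Longrightarrow> 0 < p n \<and> p n < 1"
  shows "(filterlim (\<lambda>n. (real n)\<^sup>2 * p n * (1 - p n)) at_top sequentially \<longrightarrow>
            weak_conv_m
              (\<lambda>n. distr (measure_pmf (gnp n (p n))) borel
                 (\<lambda>G. (zagreb k n G - zagreb_center k n (p n)) / zagreb_scale k n (p n)))
              std_normal_distribution) \<and>
         ((\<exists>a b :: nat \<Rightarrow> real.
            weak_conv_m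
              (\<lambda>n. distr (measure_pmf (gnp n (p n))) borel (\<lambda>G. (zagreb k n G - a n) / b n))
              std_normal_distribution) \<longrightarrow>
          filterlim (\<lambda>n. (real n)\<^sup>2 * p n * (1 - p n)) at_top sequentially)"
proof (intro conjI impI)
  assume "filterlim (\<lambda>n. (real n)\<^sup>2 * p n * (1 - p n)) at_top sequentially"
  then show "weak_conv_m
      (\<lambda>n. distr (measure_pmf (gnp n (p n))) borel
         (\<lambda>G. (zagreb k n G - zagreb_center k n (p n)) / zagreb_scale k n (p n)))
      std_normal_distribution"
    by (intro zagreb_clt assms)
next
  assume "\<exists>a b :: nat \<Rightarrow> real.
      weak_conv_m
        (\<lambda>n. distr (measure_pmf (gnp n (p n))) borel (\<lambda>G. (zagreb k n G - a n) / b n))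
        std_normal_distribution"
  then obtain a b where "weak_conv_m
      (\<lambda>n. distr (measure_pmf (gnp n (p n))) borel (\<lambda>G. (zagreb k n G - a n) / b n))
      std_normal_distribution"
    by blast
  then show "filterlim (\<lambda>n. (real n)\<^sup>2 * p n * (1 - p n)) at_top sequentially"
    by (intro variance_at_top_of_weak_conv[OF assms(2)])
qed

end
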